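(* Let $p\ge 3$ be a prime. Let $\alpha$ be a zero of the polynomial $x^p+x^{p-1}+2$ and $F=\mathbb{Q}(\alpha)$. Then, in $K_2(F)$, $$1\neq c_p(\alpha)^2=c_p(\alpha^2)\in G_p(F).$$
   Context: $K_2(F)$ is the Milnor $K_2$-group of $F$ (written multiplicatively, generated by symbols $\{a,b\}$, $a,b\in F^*$). $\Phi_p(x)$ is the $p$-th cyclotomic polynomial; for $a\in F^*$ with $\Phi_p(a)\neq 0$, $c_p(a)=\{a,\Phi_p(a)\}\in K_2(F)$, and $G_p(F)=\{c_p(a)\mid a,\Phi_p(a)\in F^*\}$. *)

theory Defs
  imports
    "HOL-Algebra.Algebraic_Closure_Type"
    "HOL-Algebra.Free_Abelian_Groups"
    "HOL-Algebra.Generated_Fields"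
    "HOL-Computational_Algebra.Computational_Algebra"
    Complex_Main
begin

section \<open>The Milnor group of a field\<close>

text \<open>
  The free Abelian group of the library is written additively on finitely supported
  integer-valued functions, so the relators below are differences: bilinearity in each argument
  and the Steinberg relation. The group \<open>milnor_K2 R\<close> itself is a multiplicative \<open>monoid\<close> record.
\<close>

definition K2_relators :: "('a, 'b) ring_scheme \<Rightarrow> (('a \<times> 'a) \<Rightarrow>\<^sub>0 int) set" where
  "K2_relators R =
     {frag_of (a \<otimes>\<^bsub>R\<^esub> b, c) - frag_of (a, c) - frag_of (b, c) | a b c.
        a \<in> carrier (mult_of R) \<and> b \<in> carrier (mult_of R) \<and> c \<in> carrier (mult_of R)}
   \<union> {frag_of (a, b \<otimes>\<^bsub>R\<^esub> c) - frag_of (a, b) - frag_of (a, c) | a b c.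
        a \<in> carrier (mult_of R) \<and> b \<in> carrier (mult_of R) \<and> c \<in> carrier (mult_of R)}
   \<union> {frag_of (a, \<one>\<^bsub>R\<^esub> \<ominus>\<^bsub>R\<^esub> a) | a.
        a \<in> carrier (mult_of R) \<and> \<one>\<^bsub>R\<^esub> \<ominus>\<^bsub>R\<^esub> a \<in> carrier (mult_of R)}"

abbreviation K2_free :: "('a, 'b) ring_scheme \<Rightarrow> (('a \<times> 'a) \<Rightarrow>\<^sub>0 int) monoid" where
  "K2_free R \<equiv> free_Abelian_group (carrier (mult_of R) \<times> carrier (mult_of R))"

abbreviation K2_subgroup :: "('a, 'b) ring_scheme \<Rightarrow> (('a \<times> 'a) \<Rightarrow>\<^sub>0 int) set" where
  "K2_subgroup R \<equiv> generate (K2_free R) (K2_relators R)"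

definition milnor_K2 :: "('a, 'b) ring_scheme \<Rightarrow> (('a \<times> 'a) \<Rightarrow>\<^sub>0 int) set monoid" where
  "milnor_K2 R = K2_free R Mod K2_subgroup R"

text \<open>The symbol \<open>{a, b}\<close>; meaningful only for nonzero \<open>a\<close> and \<open>b\<close>.\<close>

definition K2_symbol :: "('a, 'b) ring_scheme \<Rightarrow> 'a \<Rightarrow> 'a \<Rightarrow> (('a \<times> 'a) \<Rightarrow>\<^sub>0 int) set" where
  "K2_symbol R a b = K2_subgroup R #>\<^bsub>K2_free R\<^esub> frag_of (a, b)"

lemma (in field) K2_relators_subset: "K2_relators R \<subseteq> carrier (K2_free R)"
proof
  have *: "frag_of x - frag_of y - frag_of z \<in> carrier (free_Abelian_group S)"
    if "x \<in> S" "y \<in> S" "z \<in> S" for x y z and S :: "('a \<times> 'a) set"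
  proof -
    have "Poly_Mapping.keys (frag_of x - frag_of y - frag_of z) \<subseteq> {x, y, z}"
      using keys_diff[of "frag_of x - frag_of y" "frag_of z"] keys_diff[of "frag_of x" "frag_of y"]
      by auto
    thus ?thesis using that by auto
  qed
  have m: "a \<otimes> b \<in> carrier (mult_of R)"
    if "a \<in> carrier (mult_of R)" "b \<in> carrier (mult_of R)" for a b
    using that by (auto simp: integral_iff)
  fix r assume "r \<in> K2_relators R"
  then consider
      (left) a b c where "r = frag_of (a \<otimes> b, c) - frag_of (a, c) - frag_of (b, c)"
        "a \<in> carrier (mult_of R)" "b \<in> carrier (mult_of R)" "c \<in> carrier (mult_of R)"
    | (right) a b c where "r = frag_of (a, b \<otimes> c) - frag_of (a, b) - frag_of (a, c)"
        "a \<in> carrier (mult_of R)" "b \<in> carrier (mult_of R)" "c \<in> carrier (mult_of R)"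
    | (steinberg) a where "r = frag_of (a, \<one> \<ominus> a)"
        "a \<in> carrier (mult_of R)" "\<one> \<ominus> a \<in> carrier (mult_of R)"
    unfolding K2_relators_def by blast
  thus "r \<in> carrier (K2_free R)"
  proof cases
    case left
    show ?thesis unfolding left(1) by (rule *; intro SigmaI m left)
  next
    case right
    show ?thesis unfolding right(1) by (rule *; intro SigmaI m right)
  next
    case steinberg
    thus ?thesis by simp
  qed
qed

lemma (in field) comm_group_milnor_K2: "comm_group (milnor_K2 R)"
proof -
  interpret G: comm_group "K2_free R" by (rule abelian_free_Abelian_group)
  show ?thesis
    unfolding milnor_K2_def
    by (intro G.abelian_FactGroup G.generate_is_subgroup K2_relators_subset)
qed


section \<open>Cyclotomic polynomials\<close>

definition primitive_roots_unity :: "nat \<Rightarrow> complex set" where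
  "primitive_roots_unity n = {z. z ^ n = 1 \<and> (\<forall>m. 0 < m \<and> m < n \<longrightarrow> z ^ m \<noteq> 1)}"

definition cyclotomic_poly :: "nat \<Rightarrow> int poly" where
  "cyclotomic_poly n =
     (THE q. map_poly of_int q = (\<Prod>z\<in>primitive_roots_unity n. [:- z, 1:]))"

lemma cyclotomic_poly_prime:
  assumes "Factorial_Ring.prime (p :: nat)"
  shows "cyclotomic_poly p = (\<Sum>i<p. Polynomial.monom 1 i)"
proof -
  have p: "p > 1" using assms by (rule prime_gt_1_nat)
  have prim: "primitive_roots_unity p = {z. z ^ p = 1} - {1}"
  proof (intro equalityI subsetI)
    fix z assume "z \<in> primitive_roots_unity p"
    hence "z ^ p = 1" "z ^ 1 \<noteq> 1" using p unfolding primitive_roots_unity_def by blast+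
    thus "z \<in> {z. z ^ p = 1} - {1}" by simp
  next
    fix z :: complex assume z: "z \<in> {z. z ^ p = 1} - {1}"
    have "z ^ m \<noteq> 1" if m: "0 < m" "m < p" for m
    proof
      assume zm: "z ^ m = 1"
      have "coprime m p"
        using assms m by (metis coprime_commute nat_dvd_not_less prime_imp_coprime)
      then obtain x y where xy: "m * x = p * y + 1"
        using m bezout_nat[of m p] by (auto simp: coprime_iff_gcd_eq_1)
      have "z ^ (m * x) = 1" using zm by (simp add: power_mult)
      moreover have "z ^ (p * y + 1) = z" using z by (simp add: power_mult)
      ultimately show False using xy z by simp
    qed
    thus "z \<in> primitive_roots_unity p" using z by (simp add: primitive_roots_unity_def)
  qed
  define A :: "complex set" where "A = {z. z ^ p = 1}"
  have finA: "finite A" "card A = p"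
    using p finite_roots_unity[of p, where ?'a = complex] card_roots_unity_eq[of p] by (auto simp: A_def)
  define xp where "xp = (Polynomial.monom 1 p - 1 :: complex poly)"
  have degX: "Polynomial.degree xp = p" "Polynomial.lead_coeff xp = 1"
  proof -
    show d: "Polynomial.degree xp = p"
    proof (rule antisym)
      show "Polynomial.degree xp \<le> p" unfolding xp_def by (intro degree_diff_le) (auto simp: degree_monom_eq)
      show "p \<le> Polynomial.degree xp" using p by (intro le_degree) (simp add: xp_def)
    qed
    show "Polynomial.lead_coeff xp = 1" unfolding d using p by (simp add: xp_def)
  qed
  have full: "(\<Prod>z\<in>A. [:- z, 1:]) = xp"
  proof (rule poly_eqI_degree_lead_coeff[where n = p and A = A])
    have dP: "Polynomial.degree (\<Prod>z\<in>A. [:- z, 1:]) = p"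
      using finA by (subst degree_prod_eq_sum_degree) auto
    have "Polynomial.lead_coeff (\<Prod>z\<in>A. [:- z, 1:]) = 1"
      by (subst lead_coeff_prod) auto
    thus "Polynomial.coeff (\<Prod>z\<in>A. [:- z, 1:]) p = Polynomial.coeff xp p" using dP degX by simp
    show "Polynomial.degree (\<Prod>z\<in>A. [:- z, 1:]) \<le> p" using dP by simp
    show "poly (\<Prod>z\<in>A. [:- z, 1:]) z = poly xp z" if "z \<in> A" for z
      using that finA by (auto simp: poly_prod xp_def poly_monom A_def)
  qed (use finA degX in auto)
  have sumX: "[:- 1, 1:] * (\<Sum>i<p. Polynomial.monom 1 i) = xp"
  proof (rule iffD1[OF poly_eq_poly_eq_iff], rule ext)
    fix x
    show "poly ([:- 1, 1:] * (\<Sum>i<p. Polynomial.monom 1 i)) x = poly xp x"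
      using power_diff_1_eq[of x p] by (simp add: xp_def poly_sum poly_monom algebra_simps)
  qed
  have "(\<Prod>z\<in>A. [:- z, 1:]) = [:- 1, 1:] * (\<Prod>z\<in>A - {1}. [:- z, 1:])"
    using finA by (intro prod.remove) (auto simp: A_def)
  hence "[:- 1, 1:] * (\<Prod>z\<in>A - {1}. [:- z, 1:]) = [:- 1, 1:] * (\<Sum>i<p. Polynomial.monom (1::complex) i)"
    using full sumX by simp
  hence key: "(\<Prod>z\<in>primitive_roots_unity p. [:- z, 1:]) = (\<Sum>i<p. Polynomial.monom 1 i)"
    unfolding prim A_def[symmetric] by (subst (asm) mult_cancel_left) auto
  have mp: "map_poly of_int (\<Sum>i<p. Polynomial.monom (1::int) i) = (\<Sum>i<p. Polynomial.monom (1::complex) i)"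
    by (intro poly_eqI) (simp add: coeff_map_poly coeff_sum)
  show ?thesis unfolding cyclotomic_poly_def
  proof (rule the_equality)
    fix q :: "int poly"
    assume "map_poly of_int q = (\<Prod>z\<in>primitive_roots_unity p. [:- z, 1:])"
    hence *: "map_poly complex_of_int q = map_poly of_int (\<Sum>i<p. Polynomial.monom (1::int) i)"
      using key mp by simp
    show "q = (\<Sum>i<p. Polynomial.monom 1 i)"
    proof (rule poly_eqI)
      fix n
      have "complex_of_int (Polynomial.coeff q n)
              = complex_of_int (Polynomial.coeff (\<Sum>i<p. Polynomial.monom 1 i) n)"
        using arg_cong[OF *, of "\<lambda>r. Polynomial.coeff r n"] by (simp add: coeff_map_poly)
      thus "Polynomial.coeff q n = Polynomial.coeff (\<Sum>i<p. Polynomial.monom 1 i) n"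
        by (simp only: of_int_eq_iff)
    qed
  qed (use key mp in simp)
qed

definition cyclotomic_eval :: "('a, 'b) ring_scheme \<Rightarrow> nat \<Rightarrow> 'a \<Rightarrow> 'a" where
  "cyclotomic_eval R n a =
     (\<Oplus>\<^bsub>R\<^esub>i\<in>{..Polynomial.degree (cyclotomic_poly n)}.
        [Polynomial.coeff (cyclotomic_poly n) i] \<cdot>\<^bsub>R\<^esub> (a [^]\<^bsub>R\<^esub> i))"

lemma (in ring) cyclotomic_eval_prime:
  assumes "Factorial_Ring.prime (p :: nat)" and "a \<in> carrier R"
  shows "cyclotomic_eval R p a = (\<Oplus>i\<in>{..<p}. a [^] i)"
proof -
  have p: "p > 0" using assms(1) by (rule prime_gt_0_nat)
  have c: "Polynomial.coeff (cyclotomic_poly p) i = (if i < p then 1 else 0)" for i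
    using cyclotomic_poly_prime[OF assms(1)] by (simp add: coeff_sum)
  have "Polynomial.degree (cyclotomic_poly p) = p - 1"
  proof (rule antisym)
    show "Polynomial.degree (cyclotomic_poly p) \<le> p - 1" by (rule degree_le) (auto simp: c)
    show "p - 1 \<le> Polynomial.degree (cyclotomic_poly p)" using p by (intro le_degree) (simp add: c)
  qed
  hence "{..Polynomial.degree (cyclotomic_poly p)} = {..<p}" using p by (cases p) (simp_all add: lessThan_Suc_atMost)
  thus ?thesis unfolding cyclotomic_eval_def using assms(2)
    by (intro add.finprod_cong') (simp_all add: c add.int_pow_1 Pi_iff)
qed

definition K2_cyclotomic :: "('a, 'b) ring_scheme \<Rightarrow> nat \<Rightarrow> 'a \<Rightarrow> (('a \<times> 'a) \<Rightarrow>\<^sub>0 int) set" where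
  "K2_cyclotomic R n a = K2_symbol R a (cyclotomic_eval R n a)"

text \<open>A set of elements of \<open>milnor_K2 R\<close>, not the subgroup they generate.\<close>

definition K2_cyclotomic_set :: "('a, 'b) ring_scheme \<Rightarrow> nat \<Rightarrow> (('a \<times> 'a) \<Rightarrow>\<^sub>0 int) set set" where
  "K2_cyclotomic_set R n =
     {K2_cyclotomic R n a | a.
        a \<in> carrier (mult_of R) \<and> cyclotomic_eval R n a \<in> carrier (mult_of R)}"


section \<open>Simple extensions of the rationals\<close>

text \<open>
  In characteristic 0 the subfield generated by \<open>x\<close> contains the prime field, that is, the rationals.
\<close>

definition rat_adjoin :: "'a::field_char_0 \<Rightarrow> 'a ring" where
  "rat_adjoin x = ring_of_type_algebra\<lparr>carrier := generate_field ring_of_type_algebra {x}\<rparr>"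

lemma field_rat_adjoin: "field (rat_adjoin x)"
proof -
  interpret K: field "ring_of_type_algebra :: 'a ring" by (rule field_from_type_algebra)
  show ?thesis unfolding rat_adjoin_def
    by (rule K.generate_field_is_field) (simp add: ring_of_type_algebra_def)
qed

end

theory Submission
  imports Defs "HOL-Number_Theory.Residue_Primitive_Roots"
begin

text \<open>
  Let \<open>u = \<Phi>\<^sub>p(\<alpha>)\<close> and \<open>w = \<Phi>\<^sub>p(\<alpha>\<^sup>2)\<close>. Then \<open>w (1 + \<alpha>) = u (1 + \<alpha>\<^sup>p)\<close>, so the equality
  \<open>{\<alpha>\<^sup>2, w} = {\<alpha>, u}\<^sup>2\<close> holds as soon as \<open>{\<alpha>, 1 + \<alpha>}\<^sup>2\<close> and \<open>{\<alpha>, 1 + \<alpha>\<^sup>p}\<^sup>2\<close> are trivial. The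
  Steinberg relation gives \<open>{x, 1 + x}\<^sup>2 = 1\<close> for every \<open>x\<close>. With \<open>x = \<alpha>\<close> this is the first claim; with
  \<open>x = \<alpha>\<^sup>p\<close> it shows that \<open>{\<alpha>, 1 + \<alpha>\<^sup>p}\<^sup>2\<close> is killed by \<open>p\<close>. The equation of \<open>\<alpha>\<close> says
  \<open>1 + \<alpha>\<^sup>p = -(1 + \<alpha>\<^sup>p\<^sup>-\<^sup>1)\<close>, so with \<open>x = \<alpha>\<^sup>p\<^sup>-\<^sup>1\<close> the same element is killed by \<open>p - 1\<close>, and
  it is trivial. This is \<open>K2_symbol_square_eq\<close>.

  Nontriviality is detected by a tame symbol. Let \<open>q\<close> be a prime factor of \<open>(3\<^sup>p + 1) / 4\<close>. Modulo
  \<open>q\<close> the number \<open>-1/3\<close> is a primitive \<open>p\<close>-th root of unity and a simple root of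
  \<open>f = x\<^sup>p + x\<^sup>p\<^sup>-\<^sup>1 + 2\<close>, so it lifts to a \<open>q\<close>-adic root of \<open>f\<close>. As \<open>f\<close> is irreducible
  (\<open>prime_elem_trinomial\<close>), this defines a place of \<open>\<rat>(\<alpha>)\<close> with residue field \<open>\<int>/q\<close>. There \<open>\<alpha>\<close> is
  a unit with residue \<open>-1/3\<close>, and \<open>x f(x) = (x\<^sup>p - 1)(x + 1) + (3 x + 1)\<close> shows that the valuation of
  \<open>u\<close> is that of \<open>3 \<alpha> + 1\<close>, which is the exponent \<open>e\<close> of \<open>q\<close> in \<open>3\<^sup>p + 1\<close> (\<open>v_cyclotomic\<close>). The
  tame symbol sends \<open>{\<alpha>, u}\<close> to \<open>(-1/3)\<^sup>e\<close>. Since \<open>0 < e < p\<close>, this has order \<open>p\<close>, so that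
  \<open>{\<alpha>, u}\<^sup>2 \<noteq> 1\<close>.

  In place of \<open>q\<close>-adic numbers, the proof uses a sequence of integers that are roots of \<open>f\<close> to
  increasing precision. Substituting the \<open>n\<close>-th one for \<open>\<alpha>\<close> gives an approximate tame symbol, and each
  of the defining relations of \<open>K\<^sub>2\<close> holds for it when \<open>n\<close> is large. This is enough, since a
  trivial element is a combination of finitely many relators (\<open>K2_subgroup_functional\<close>).
\<close>

section \<open>Symbols in the Milnor group\<close>

lemma (in domain) nat_pow_nonzero:
  "a \<in> carrier R - {\<zero>} \<Longrightarrow> a [^] (n :: nat) \<noteq> \<zero>"
  by (induction n) (auto simp: integral_iff)

lemma (in field) K2_subgroup_normal: "K2_subgroup R \<lhd> K2_free R"
proof -
  interpret G: comm_group "K2_free R" by (rule abelian_free_Abelian_group)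
  show ?thesis
    unfolding G.normal_iff_subgroup by (rule G.generate_is_subgroup[OF K2_relators_subset])
qed

lemma (in field) K2_class_hom:
  "group_hom (K2_free R) (milnor_K2 R) (\<lambda>w. K2_subgroup R #>\<^bsub>K2_free R\<^esub> w)"
proof -
  interpret K: comm_group "milnor_K2 R" by (rule comm_group_milnor_K2)
  interpret N: normal "K2_subgroup R" "K2_free R" by (rule K2_subgroup_normal)
  show ?thesis
    by unfold_locales (use N.r_coset_hom_Mod in \<open>simp add: milnor_K2_def\<close>)
qed

lemma (in field) K2_class_eq_one_iff:
  assumes "w \<in> carrier (K2_free R)"
  shows "K2_subgroup R #>\<^bsub>K2_free R\<^esub> w = \<one>\<^bsub>milnor_K2 R\<^esub> \<longleftrightarrow> w \<in> K2_subgroup R"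
proof -
  interpret N: normal "K2_subgroup R" "K2_free R" by (rule K2_subgroup_normal)
  have "\<one>\<^bsub>milnor_K2 R\<^esub> = K2_subgroup R" by (simp add: milnor_K2_def FactGroup_def)
  thus ?thesis
    using N.coset_join1[OF _ assms N.is_subgroup] N.coset_join2[OF assms N.is_subgroup]
    by (metis N.rcos_self N.is_subgroup assms)
qed

lemma (in field) K2_class_relator:
  assumes "w \<in> K2_relators R"
  shows "K2_subgroup R #>\<^bsub>K2_free R\<^esub> w = \<one>\<^bsub>milnor_K2 R\<^esub>"
  using K2_class_eq_one_iff[OF subsetD[OF K2_relators_subset assms]] generate.incl[OF assms] by blast

lemma (in field) K2_symbol_closed [simp]:
  assumes "a \<in> carrier R - {\<zero>}" "b \<in> carrier R - {\<zero>}"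
  shows "K2_symbol R a b \<in> carrier (milnor_K2 R)"
proof -
  interpret h: group_hom "K2_free R" "milnor_K2 R" "\<lambda>w. K2_subgroup R #>\<^bsub>K2_free R\<^esub> w"
    by (rule K2_class_hom)
  show ?thesis unfolding K2_symbol_def using assms by (intro h.hom_closed) auto
qed

text \<open>
  The common form of both bilinearity laws: a relator is a difference \<open>w - w1 - w2\<close>, and it dies in
  the quotient.
\<close>

lemma (in field) K2_class_add:
  assumes "w1 \<in> carrier (K2_free R)" "w2 \<in> carrier (K2_free R)" "w - w1 - w2 \<in> K2_relators R"
  shows "K2_subgroup R #>\<^bsub>K2_free R\<^esub> w =
    (K2_subgroup R #>\<^bsub>K2_free R\<^esub> w1) \<otimes>\<^bsub>milnor_K2 R\<^esub> (K2_subgroup R #>\<^bsub>K2_free R\<^esub> w2)"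
proof -
  interpret h: group_hom "K2_free R" "milnor_K2 R" "\<lambda>w. K2_subgroup R #>\<^bsub>K2_free R\<^esub> w"
    by (rule K2_class_hom)
  define d where "d = w - w1 - w2"
  have d: "d \<in> K2_relators R" "d \<in> carrier (K2_free R)"
    using assms(3) K2_relators_subset unfolding d_def by blast+
  have "w = d + w1 + w2" unfolding d_def by simp
  hence "w = d \<otimes>\<^bsub>K2_free R\<^esub> w1 \<otimes>\<^bsub>K2_free R\<^esub> w2" by (simp only: mult_free_Abelian_group)
  thus ?thesis
    by (simp only: h.hom_mult[OF h.G.m_closed[OF d(2) assms(1)] assms(2)] h.hom_mult[OF d(2) assms(1)]
        K2_class_relator[OF d(1)] h.H.l_one[OF h.hom_closed[OF assms(1)]])
qed

lemma (in field) K2_symbol_mult_left: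
  assumes "a \<in> carrier R - {\<zero>}" "b \<in> carrier R - {\<zero>}" "c \<in> carrier R - {\<zero>}"
  shows "K2_symbol R (a \<otimes> b) c = K2_symbol R a c \<otimes>\<^bsub>milnor_K2 R\<^esub> K2_symbol R b c"
proof -
  have "frag_of (a \<otimes> b, c) - frag_of (a, c) - frag_of (b, c) \<in> K2_relators R"
    using assms unfolding K2_relators_def carrier_mult_of by blast
  moreover have "frag_of (a, c) \<in> carrier (K2_free R)" "frag_of (b, c) \<in> carrier (K2_free R)"
    using assms by auto
  ultimately show ?thesis unfolding K2_symbol_def by (intro K2_class_add)
qed

lemma (in field) K2_symbol_mult_right:
  assumes "a \<in> carrier R - {\<zero>}" "b \<in> carrier R - {\<zero>}" "c \<in> carrier R - {\<zero>}"
  shows "K2_symbol R a (b \<otimes> c) = K2_symbol R a b \<otimes>\<^bsub>milnor_K2 R\<^esub> K2_symbol R a c"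
proof -
  have "frag_of (a, b \<otimes> c) - frag_of (a, b) - frag_of (a, c) \<in> K2_relators R"
    using assms unfolding K2_relators_def carrier_mult_of by blast
  moreover have "frag_of (a, b) \<in> carrier (K2_free R)" "frag_of (a, c) \<in> carrier (K2_free R)"
    using assms by auto
  ultimately show ?thesis unfolding K2_symbol_def by (intro K2_class_add)
qed

lemma (in field) K2_symbol_steinberg:
  assumes "a \<in> carrier R - {\<zero>}" "\<one> \<ominus> a \<in> carrier R - {\<zero>}"
  shows "K2_symbol R a (\<one> \<ominus> a) = \<one>\<^bsub>milnor_K2 R\<^esub>"
  unfolding K2_symbol_def using assms by (intro K2_class_relator) (auto simp: K2_relators_def)

lemma (in field) K2_symbol_one_left:
  assumes "b \<in> carrier R - {\<zero>}"
  shows "K2_symbol R \<one> b = \<one>\<^bsub>milnor_K2 R\<^esub>"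
proof -
  interpret K: comm_group "milnor_K2 R" by (rule comm_group_milnor_K2)
  have 1: "\<one> \<in> carrier R - {\<zero>}" by simp
  show ?thesis
    using K2_symbol_mult_left[OF 1 1 assms] K2_symbol_closed[OF 1 assms] K.l_cancel_one' by simp
qed

lemma (in field) K2_symbol_power_left:
  assumes "a \<in> carrier R - {\<zero>}" "b \<in> carrier R - {\<zero>}"
  shows "K2_symbol R (a [^] (n :: nat)) b = K2_symbol R a b [^]\<^bsub>milnor_K2 R\<^esub> n"
proof (induction n)
  case 0
  show ?case using assms by (simp add: K2_symbol_one_left)
next
  case (Suc n)
  have "a [^] n \<in> carrier R - {\<zero>}"
    using assms(1) by (simp add: nat_pow_nonzero)
  thus ?case using Suc assms by (simp add: K2_symbol_mult_left)
qed

lemma (in field) minus_nonzero_closed: "a \<in> carrier R - {\<zero>} \<Longrightarrow> \<ominus> a \<in> carrier R - {\<zero>}"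
  by (metis Diff_iff a_inv_closed local.minus_minus minus_zero singleton_iff)

text \<open>
  The Steinberg relation gives \<open>{-x, 1 + x} = 1\<close>, and \<open>x\<close> differs from \<open>-x\<close> by a sign, which
  squaring removes.
\<close>

lemma (in field) K2_symbol_one_plus_square:
  assumes "x \<in> carrier R - {\<zero>}" "\<one> \<oplus> x \<in> carrier R - {\<zero>}"
  shows "K2_symbol R x (\<one> \<oplus> x) [^]\<^bsub>milnor_K2 R\<^esub> (2 :: nat) = \<one>\<^bsub>milnor_K2 R\<^esub>"
proof -
  interpret K: comm_group "milnor_K2 R" by (rule comm_group_milnor_K2)
  have mx: "\<ominus> x \<in> carrier R - {\<zero>}" by (rule minus_nonzero_closed[OF assms(1)])
  have eq: "\<one> \<ominus> (\<ominus> x) = \<one> \<oplus> x" using assms(1) by (simp add: minus_eq)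
  have sq: "x [^] (2 :: nat) = (\<ominus> x) [^] (2 :: nat)"
    using assms(1) by (simp add: numeral_2_eq_2 l_minus r_minus)
  have "K2_symbol R x (\<one> \<oplus> x) [^]\<^bsub>milnor_K2 R\<^esub> (2 :: nat)
          = K2_symbol R (\<ominus> x) (\<one> \<oplus> x) [^]\<^bsub>milnor_K2 R\<^esub> (2 :: nat)"
    by (simp only: K2_symbol_power_left[OF assms, symmetric] K2_symbol_power_left[OF mx assms(2), symmetric] sq)
  also have "K2_symbol R (\<ominus> x) (\<one> \<oplus> x) = \<one>\<^bsub>milnor_K2 R\<^esub>"
    using K2_symbol_steinberg[OF mx] assms(2) by (simp add: eq)
  finally show ?thesis by simp
qed

lemma (in field) K2_symbol_one_plus_power:
  assumes "x \<in> carrier R - {\<zero>}" "\<one> \<oplus> x [^] (k :: nat) \<in> carrier R - {\<zero>}"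
  shows "(K2_symbol R x (\<one> \<oplus> x [^] k) [^]\<^bsub>milnor_K2 R\<^esub> (2 :: nat)) [^]\<^bsub>milnor_K2 R\<^esub> k
           = \<one>\<^bsub>milnor_K2 R\<^esub>"
proof -
  interpret K: comm_group "milnor_K2 R" by (rule comm_group_milnor_K2)
  have xk: "x [^] k \<in> carrier R - {\<zero>}"
    using assms(1) by (simp add: nat_pow_nonzero)
  show ?thesis
    using K2_symbol_one_plus_square[OF xk assms(2)] K2_symbol_closed[OF assms]
    by (simp only: K2_symbol_power_left[OF assms] K.nat_pow_pow mult.commute)
qed

lemma (in field) K2_symbol_minus_right_square:
  assumes "a \<in> carrier R - {\<zero>}" "b \<in> carrier R - {\<zero>}"
  shows "K2_symbol R a (\<ominus> b) [^]\<^bsub>milnor_K2 R\<^esub> (2 :: nat)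
           = K2_symbol R a b [^]\<^bsub>milnor_K2 R\<^esub> (2 :: nat)"
proof -
  interpret K: comm_group "milnor_K2 R" by (rule comm_group_milnor_K2)
  have mb: "\<ominus> b \<in> carrier R - {\<zero>}" by (rule minus_nonzero_closed[OF assms(2)])
  have "(\<ominus> b) \<otimes> (\<ominus> b) = b \<otimes> b" using assms by (simp add: l_minus r_minus)
  hence "K2_symbol R a (\<ominus> b) \<otimes>\<^bsub>milnor_K2 R\<^esub> K2_symbol R a (\<ominus> b)
    = K2_symbol R a b \<otimes>\<^bsub>milnor_K2 R\<^esub> K2_symbol R a b"
    by (simp only: K2_symbol_mult_right[OF assms(1) mb mb, symmetric]
        K2_symbol_mult_right[OF assms assms(2), symmetric])
  thus ?thesis using assms mb K2_symbol_closed[OF assms] K2_symbol_closed[OF assms(1) mb]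
    by (simp add: numeral_2_eq_2)
qed

text \<open>
  Taking the symbol with \<open>a\<close> in \<open>w (1 + a) = u (1 + a\<^sup>k\<^sup>+\<^sup>1)\<close>, the claim is that the squares of
  \<open>{a, 1 + a}\<close> and of \<open>{a, 1 + a\<^sup>k\<^sup>+\<^sup>1}\<close> are trivial. The second one is killed by \<open>k + 1\<close>; as
  \<open>1 + a\<^sup>k\<^sup>+\<^sup>1\<close> and \<open>1 + a\<^sup>k\<close> are equal up to sign, it is also killed by \<open>k\<close>. These exponents are
  coprime.
\<close>

theorem (in field) K2_symbol_square_eq:
  assumes a: "a \<in> carrier R - {\<zero>}" and u: "u \<in> carrier R - {\<zero>}" and w: "w \<in> carrier R - {\<zero>}"
    and a1: "\<one> \<oplus> a \<in> carrier R - {\<zero>}" and ak: "\<one> \<oplus> a [^] Suc k \<in> carrier R - {\<zero>}"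
    and quotient: "w \<otimes> (\<one> \<oplus> a) = u \<otimes> (\<one> \<oplus> a [^] Suc k)"
    and opposite: "\<one> \<oplus> a [^] Suc k = \<ominus> (\<one> \<oplus> a [^] k)"
  shows "K2_symbol R (a [^] (2 :: nat)) w = K2_symbol R a u [^]\<^bsub>milnor_K2 R\<^esub> (2 :: nat)"
proof -
  let ?K = "milnor_K2 R"
  interpret K: comm_group ?K by (rule comm_group_milnor_K2)
  define A where "A = K2_symbol R a (\<one> \<oplus> a [^] Suc k) [^]\<^bsub>?K\<^esub> (2 :: nat)"
  have A: "A \<in> carrier ?K" unfolding A_def by (intro K.nat_pow_closed K2_symbol_closed a ak)
  have ak': "\<one> \<oplus> a [^] k \<in> carrier R - {\<zero>}"
  proof -
    have "\<one> \<oplus> a [^] k = \<ominus> (\<one> \<oplus> a [^] Suc k)" using a opposite by simp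
    thus ?thesis using minus_nonzero_closed[OF ak] by simp
  qed
  have "A [^]\<^bsub>?K\<^esub> Suc k = \<one>\<^bsub>?K\<^esub>" unfolding A_def by (rule K2_symbol_one_plus_power[OF a ak])
  moreover have "A [^]\<^bsub>?K\<^esub> k = \<one>\<^bsub>?K\<^esub>"
    unfolding A_def opposite K2_symbol_minus_right_square[OF a ak'] by (rule K2_symbol_one_plus_power[OF a ak'])
  ultimately have A1: "A = \<one>\<^bsub>?K\<^esub>" using A by simp
  have "K2_symbol R a w \<otimes>\<^bsub>?K\<^esub> K2_symbol R a (\<one> \<oplus> a)
      = K2_symbol R a u \<otimes>\<^bsub>?K\<^esub> K2_symbol R a (\<one> \<oplus> a [^] Suc k)"
    by (simp only: K2_symbol_mult_right[OF a w a1, symmetric] K2_symbol_mult_right[OF a u ak, symmetric] quotient)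
  hence "(K2_symbol R a w \<otimes>\<^bsub>?K\<^esub> K2_symbol R a (\<one> \<oplus> a)) [^]\<^bsub>?K\<^esub> (2 :: nat)
      = (K2_symbol R a u \<otimes>\<^bsub>?K\<^esub> K2_symbol R a (\<one> \<oplus> a [^] Suc k)) [^]\<^bsub>?K\<^esub> (2 :: nat)"
    by (rule arg_cong)
  hence "K2_symbol R a w [^]\<^bsub>?K\<^esub> (2 :: nat) = K2_symbol R a u [^]\<^bsub>?K\<^esub> (2 :: nat)"
    using A1 K2_symbol_one_plus_square[OF a a1]
      K2_symbol_closed[OF a w] K2_symbol_closed[OF a u] K2_symbol_closed[OF a ak] K2_symbol_closed[OF a a1]
    by (simp only: K.nat_pow_distrib A_def K.r_one K.nat_pow_closed)
  thus ?thesis by (simp only: K2_symbol_power_left[OF a w])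
qed

section \<open>Functionals on the Milnor group\<close>

text \<open>
  A homomorphism from \<open>K\<^sub>2\<close> to \<open>\<int>/M\<close> amounts to a bilinear function of pairs that respects the
  Steinberg relation. Here one has a whole family of functions \<open>t n\<close>, and each relation is required
  only for eventually all \<open>n\<close>. As an element of the relation subgroup involves only finitely many
  relators, it is still killed for eventually all \<open>n\<close>. The values of \<open>t n\<close> are extended additively
  by means of the free Abelian group on one generator, a copy of the integers.
\<close>

lemma (in field) K2_subgroup_functional:
  fixes t :: "'n \<Rightarrow> 'a \<times> 'a \<Rightarrow> int"
  assumes left: "\<And>a b c. \<lbrakk>a \<in> carrier R - {\<zero>}; b \<in> carrier R - {\<zero>}; c \<in> carrier R - {\<zero>}\<rbrakk> \<Longrightarrow>
      \<forall>\<^sub>F n in F. M dvd t n (a \<otimes> b, c) - t n (a, c) - t n (b, c)"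
    and right: "\<And>a b c. \<lbrakk>a \<in> carrier R - {\<zero>}; b \<in> carrier R - {\<zero>}; c \<in> carrier R - {\<zero>}\<rbrakk> \<Longrightarrow>
      \<forall>\<^sub>F n in F. M dvd t n (a, b \<otimes> c) - t n (a, b) - t n (a, c)"
    and steinberg: "\<And>a. \<lbrakk>a \<in> carrier R - {\<zero>}; \<one> \<ominus> a \<in> carrier R - {\<zero>}\<rbrakk> \<Longrightarrow>
      \<forall>\<^sub>F n in F. M dvd t n (a, \<one> \<ominus> a)"
    and "w \<in> K2_subgroup R"
  shows "\<forall>\<^sub>F n in F. M dvd
    Poly_Mapping.lookup (frag_extend (\<lambda>x. frag_cmul (t n x) (frag_of ())) w) ()"
proof -
  define L where "L n w = Poly_Mapping.lookup (frag_extend (\<lambda>x. frag_cmul (t n x) (frag_of ())) w) ()" for n w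
  have L: "L n 0 = 0" "L n (frag_of x) = t n x" "L n (v + w) = L n v + L n w"
      "L n (v - w) = L n v - L n w" "L n (- v) = - L n v" for n x v w
    unfolding L_def by (simp_all add: frag_extend_add frag_extend_diff frag_extend_minus lookup_add lookup_minus lookup_frag_of)
  have relator: "\<forall>\<^sub>F n in F. M dvd L n r" if "r \<in> K2_relators R" for r
  proof -
    from that consider
        (left) a b c where "r = frag_of (a \<otimes> b, c) - frag_of (a, c) - frag_of (b, c)"
          "a \<in> carrier R - {\<zero>}" "b \<in> carrier R - {\<zero>}" "c \<in> carrier R - {\<zero>}"
      | (right) a b c where "r = frag_of (a, b \<otimes> c) - frag_of (a, b) - frag_of (a, c)"
          "a \<in> carrier R - {\<zero>}" "b \<in> carrier R - {\<zero>}" "c \<in> carrier R - {\<zero>}"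
      | (steinberg) a where "r = frag_of (a, \<one> \<ominus> a)"
          "a \<in> carrier R - {\<zero>}" "\<one> \<ominus> a \<in> carrier R - {\<zero>}"
      unfolding K2_relators_def carrier_mult_of by blast
    thus ?thesis
      by cases (use left right steinberg in \<open>simp_all only: L\<close>)
  qed
  from assms(4) have "\<forall>\<^sub>F n in F. M dvd L n w"
  proof induction
    case one
    show ?case by (simp add: L)
  next
    case (incl r)
    thus ?case by (rule relator)
  next
    case (inv r)
    have "Poly_Mapping.keys r \<subseteq> carrier (mult_of R) \<times> carrier (mult_of R)"
      using subsetD[OF K2_relators_subset inv] by (simp only: carrier_free_Abelian_group_iff)
    hence "inv\<^bsub>K2_free R\<^esub> r = - r" by (rule inv_free_Abelian_group)
    thus ?case using relator[OF inv] by (simp add: L)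
  next
    case (eng v w)
    thus ?case by (auto simp: L elim: eventually_elim2)
  qed
  thus ?thesis unfolding L_def .
qed

corollary (in field) K2_symbol_square_functional:
  fixes t :: "'n \<Rightarrow> 'a \<times> 'a \<Rightarrow> int"
  assumes left: "\<And>a b c. \<lbrakk>a \<in> carrier R - {\<zero>}; b \<in> carrier R - {\<zero>}; c \<in> carrier R - {\<zero>}\<rbrakk> \<Longrightarrow>
      \<forall>\<^sub>F n in F. M dvd t n (a \<otimes> b, c) - t n (a, c) - t n (b, c)"
    and right: "\<And>a b c. \<lbrakk>a \<in> carrier R - {\<zero>}; b \<in> carrier R - {\<zero>}; c \<in> carrier R - {\<zero>}\<rbrakk> \<Longrightarrow>
      \<forall>\<^sub>F n in F. M dvd t n (a, b \<otimes> c) - t n (a, b) - t n (a, c)"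
    and steinberg: "\<And>a. \<lbrakk>a \<in> carrier R - {\<zero>}; \<one> \<ominus> a \<in> carrier R - {\<zero>}\<rbrakk> \<Longrightarrow>
      \<forall>\<^sub>F n in F. M dvd t n (a, \<one> \<ominus> a)"
    and ab: "a \<in> carrier R - {\<zero>}" "b \<in> carrier R - {\<zero>}"
    and trivial: "K2_symbol R a b [^]\<^bsub>milnor_K2 R\<^esub> (2 :: nat) = \<one>\<^bsub>milnor_K2 R\<^esub>"
  shows "\<forall>\<^sub>F n in F. M dvd 2 * t n (a, b)"
proof -
  interpret h: group_hom "K2_free R" "milnor_K2 R" "\<lambda>w. K2_subgroup R #>\<^bsub>K2_free R\<^esub> w"
    by (rule K2_class_hom)
  have ab': "frag_of (a, b) \<in> carrier (K2_free R)" using ab by auto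
  have "K2_subgroup R #>\<^bsub>K2_free R\<^esub> (frag_of (a, b) [^]\<^bsub>K2_free R\<^esub> (2 :: nat)) = \<one>\<^bsub>milnor_K2 R\<^esub>"
    using trivial unfolding K2_symbol_def h.hom_nat_pow[OF ab'] .
  hence "frag_of (a, b) [^]\<^bsub>K2_free R\<^esub> (2 :: nat) \<in> K2_subgroup R"
    using K2_class_eq_one_iff[OF h.G.nat_pow_closed[OF ab']] by blast
  from K2_subgroup_functional[OF left right steinberg this] show ?thesis
    by (simp add: frag_extend_cmul)
qed

section \<open>Valuation and leading digit of an integer at an odd prime\<close>

text \<open>
  A choice that depends on the residue class of \<open>u\<close> only, with an arbitrary value if \<open>q\<close> divides \<open>u\<close>.
\<close>

definition discrete_log :: "nat \<Rightarrow> nat \<Rightarrow> int \<Rightarrow> nat" where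
  "discrete_log q \<gamma> u = (SOME k. [int \<gamma> ^ k = u] (mod int q))"

text \<open>
  The logarithm of the leading \<open>q\<close>-adic digit.
\<close>

definition angular_log :: "nat \<Rightarrow> nat \<Rightarrow> int \<Rightarrow> nat" where
  "angular_log q \<gamma> A = discrete_log q \<gamma> (A div int q ^ multiplicity (int q) A)"

lemma discrete_log_cong: "[u = u'] (mod int q) \<Longrightarrow> discrete_log q \<gamma> u = discrete_log q \<gamma> u'"
  unfolding discrete_log_def using cong_trans cong_sym by (metis (no_types, opaque_lifting))

text \<open>
  Logarithms to the base of a primitive root are determined modulo \<open>q - 1\<close>. They are used only
  modulo \<open>M = (q - 1) / 2\<close>: the logarithm of \<open>-1\<close> is \<open>M\<close>, so signs disappear, in particular the sign
  \<open>(-1)\<^bsup>v(x)v(y)\<^esup>\<close> in the tame symbol.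
\<close>

locale odd_prime_primroot =
  fixes q \<gamma> :: nat
  assumes prime: "Factorial_Ring.prime q" and odd: "odd q" and primroot: "residue_primroot q \<gamma>"
begin

abbreviation M :: int where "M \<equiv> (int q - 1) div 2"
abbreviation dlog where "dlog \<equiv> discrete_log q \<gamma>"
abbreviation v where "v \<equiv> multiplicity (int q)"
abbreviation l where "l \<equiv> angular_log q \<gamma>"

lemma prime_int: "Factorial_Ring.prime (int q)"
  using prime by simp

lemma two_M: "2 * M = int q - 1"
  using odd by simp

lemma gen_power_eq_iff: "[int \<gamma> ^ i = int \<gamma> ^ j] (mod int q) \<longleftrightarrow> int q - 1 dvd int i - int j"
proof -
  have q1: "q > 1" using prime prime_gt_1_nat by blast
  have "[int \<gamma> ^ i = int \<gamma> ^ j] (mod int q) \<longleftrightarrow> [\<gamma> ^ i = \<gamma> ^ j] (mod q)"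
    by (metis cong_int_iff of_nat_power)
  also have "\<dots> \<longleftrightarrow> [i = j] (mod (q - 1))"
    using primroot prime by (subst order_divides_expdiff) (auto simp: residue_primroot_def totient_prime)
  also have "\<dots> \<longleftrightarrow> [int i = int j] (mod (int q - 1))"
    using q1 by (metis cong_int_iff of_nat_1 of_nat_diff less_imp_le_nat)
  finally show ?thesis by (simp add: cong_iff_dvd_diff)
qed

lemma dlog_spec: 
  assumes "\<not> int q dvd u"
  shows "[int \<gamma> ^ dlog u = u] (mod int q)"
proof -
  have q1: "q > 1" using prime prime_gt_1_nat by blast
  define x where "x = nat (u mod int q)"
  have x: "int x = u mod int q" using q1 by (simp add: x_def)
  have "x \<noteq> 0" using assms x by (metis dvd_eq_mod_eq_0 of_nat_0)
  moreover have "x < q" using x q1 by (metis of_nat_less_iff pos_mod_bound of_nat_0_less_iff less_trans zero_less_one)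
  ultimately have "x \<in> totatives q" using prime by (auto simp: totatives_prime)
  then obtain i where "x = \<gamma> ^ i mod q"
    using residue_primroot_is_generator[OF q1 primroot] unfolding bij_betw_def by blast
  hence "[int \<gamma> ^ i = u] (mod int q)"
    using x by (simp add: cong_def of_nat_mod)
  thus ?thesis unfolding discrete_log_def by (rule someI)
qed

lemma not_dvd_mult: "\<not> int q dvd u \<Longrightarrow> \<not> int q dvd u' \<Longrightarrow> \<not> int q dvd u * u'"
  using prime_int by (simp add: prime_dvd_mult_iff)

lemma dlog_mult:
  assumes "\<not> int q dvd u" "\<not> int q dvd u'"
  shows "int q - 1 dvd int (dlog (u * u')) - (int (dlog u) + int (dlog u'))"
proof -
  have "[int \<gamma> ^ dlog (u * u') = int \<gamma> ^ (dlog u + dlog u')] (mod int q)"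
    using dlog_spec[OF assms(1)] dlog_spec[OF assms(2)] dlog_spec[OF not_dvd_mult[OF assms]]
    unfolding power_add by (meson cong_mult cong_sym cong_trans)
  thus ?thesis by (simp add: gen_power_eq_iff)
qed

lemma dlog_minus:
  assumes "\<not> int q dvd u"
  shows "M dvd int (dlog (- u)) - int (dlog u)"
proof -
  have mu: "\<not> int q dvd - u" using assms by simp
  have "int q - 1 dvd (int (dlog (u * u)) - 2 * int (dlog u)) - (int (dlog (u * u)) - 2 * int (dlog (- u)))"
    using dvd_diff[OF dlog_mult[OF assms assms] dlog_mult[OF mu mu]] by simp
  hence "2 * M dvd 2 * (int (dlog (- u)) - int (dlog u))" unfolding two_M by (simp add: algebra_simps)
  thus ?thesis by (simp only: dvd_mult_cancel_left) simp
qed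

lemma decompose:
  assumes "A \<noteq> 0"
  obtains u where "A = int q ^ v A * u" "\<not> int q dvd u" "l A = dlog u"
proof -
  define u where "u = A div int q ^ v A"
  have 1: "A = int q ^ v A * u" unfolding u_def by (simp add: multiplicity_dvd)
  have "\<not> int q dvd u"
    unfolding u_def using assms prime_int by (intro multiplicity_decompose) auto
  thus ?thesis using that[OF 1] by (simp add: angular_log_def u_def)
qed

lemma v_l_eqI:
  assumes "A = int q ^ m * u" "\<not> int q dvd u"
  shows "v A = m" "l A = dlog u"
proof -
  show *: "v A = m"
    by (rule multiplicity_eqI) (use assms prime_int in \<open>auto simp: mult.commute\<close>)
  show "l A = dlog u" using assms prime_int unfolding angular_log_def * by auto
qed

lemma v_mult:
  assumes "A \<noteq> 0" "B \<noteq> 0"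
  shows "v (A * B) = v A + v B"
  using assms prime_int by (intro prime_elem_multiplicity_mult_distrib) auto

lemma l_mult:
  assumes "A \<noteq> 0" "B \<noteq> 0"
  shows "M dvd int (l (A * B)) - (int (l A) + int (l B))"
proof -
  obtain u where u: "A = int q ^ v A * u" "\<not> int q dvd u" "l A = dlog u" using decompose[OF assms(1)] .
  obtain w where w: "B = int q ^ v B * w" "\<not> int q dvd w" "l B = dlog w" using decompose[OF assms(2)] .
  have "A * B = int q ^ (v A + v B) * (u * w)"
    by (subst u(1), subst w(1)) (simp add: power_add)
  hence "l (A * B) = dlog (u * w)" by (rule v_l_eqI) (rule not_dvd_mult[OF u(2) w(2)])
  thus ?thesis using dlog_mult[OF u(2) w(2)] two_M by (metis dvd_trans dvd_triv_right u(3) w(3))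
qed

text \<open>
  Divided by \<open>q\<^bsup>v(A)\<^esup>\<close>, the difference \<open>A - B\<close> is still a multiple of \<open>q\<close>; so the cofactors of this power in
  \<open>A\<close> and \<open>B\<close> have the same nonzero residue.
\<close>

lemma close:
  assumes "\<not> int q ^ N dvd A" "int q ^ N dvd A - B"
  shows "B \<noteq> 0" "v B = v A" "l B = l A"
proof -
  have A: "A \<noteq> 0" using assms by auto
  obtain u where u: "A = int q ^ v A * u" "\<not> int q dvd u" "l A = dlog u" using decompose[OF A] .
  have "v A < N" using assms(1) A prime_int by (metis multiplicity_dvd' not_le)
  hence "int q ^ Suc (v A) dvd A - B" using assms(2) by (meson Suc_leI dvd_trans le_imp_power_dvd)
  then obtain k where "A - B = int q ^ Suc (v A) * k" by blast
  hence "B = int q ^ v A * (u - int q * k)" using u(1) by (simp add: algebra_simps)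
  moreover have nd: "\<not> int q dvd u - int q * k" using u(2) by (simp add: dvd_diff_left_iff)
  ultimately have *: "v B = v A" "l B = dlog (u - int q * k)" by (rule v_l_eqI)+
  show "v B = v A" by (rule *)
  have "[u - int q * k = u] (mod int q)" by (simp add: cong_iff_dvd_diff)
  thus "l B = l A" using * u(3) discrete_log_cong by metis
  show "B \<noteq> 0" using \<open>B = _\<close> nd prime_int by auto
qed

lemma l_minus:
  assumes "A \<noteq> 0"
  shows "M dvd int (l (- A)) - int (l A)"
proof -
  obtain u where u: "A = int q ^ v A * u" "\<not> int q dvd u" "l A = dlog u" using decompose[OF assms] .
  have "- A = int q ^ v A * (- u)" by (subst u(1)) simp
  hence "l (- A) = dlog (- u)" by (rule v_l_eqI) (use u in simp)
  thus ?thesis using dlog_minus[OF u(2)] u(3) by simp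
qed

lemma add_lower:
  assumes "A \<noteq> 0" "v A < v B"
  shows "v (A + B) = v A" "l (A + B) = l A"
proof -
  have "\<not> int q ^ Suc (v A) dvd A"
    using assms prime_int by (metis Suc_n_not_le_n multiplicity_geI not_prime_unit)
  moreover have "int q ^ Suc (v A) dvd A - (A + B)"
    using multiplicity_dvd'[of "Suc (v A)" "int q" B] assms by simp
  ultimately show "v (A + B) = v A" "l (A + B) = l A" using close by blast+
qed

text \<open>
  For rational numbers \<open>x = A / (A + B)\<close> and \<open>y = B / (A + B)\<close> with sum 1 this is the vanishing of the
  tame symbol \<open>v(y) l(x) - v(x) l(y)\<close>. If \<open>A\<close> and \<open>B\<close> have different valuations, the sum has the
  leading digit of the dominant one, which makes one of \<open>x\<close>, \<open>y\<close> a principal unit. If all three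
  valuations agree, \<open>x\<close> and \<open>y\<close> are units. If only the sum has a larger one, the leading digits of
  \<open>A\<close> and \<open>B\<close> are opposite, and so \<open>l(x) = l(y)\<close> modulo \<open>M\<close>, while \<open>v(x) = v(y)\<close>.
\<close>

lemma steinberg:
  assumes "A \<noteq> 0" "B \<noteq> 0" "A + B \<noteq> 0"
  shows "M dvd (int (v B) - int (v (A + B))) * (int (l A) - int (l (A + B)))
             - (int (v A) - int (v (A + B))) * (int (l B) - int (l (A + B)))"
proof -
  consider "v A < v B" | "v B < v A" | "v A = v B" by linarith
  thus ?thesis
  proof cases
    case 1
    thus ?thesis using add_lower[of A B] assms by simp
  next
    case 2
    thus ?thesis using add_lower[of B A] assms by (simp add: add.commute)
  next
    case 3
    have ge: "v A \<le> v (A + B)"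
      using assms prime_int 3
      by (intro multiplicity_geI) (auto intro!: dvd_add simp: multiplicity_dvd multiplicity_dvd')
    show ?thesis
    proof (cases "v (A + B) = v A")
      case True
      thus ?thesis using 3 by simp
    next
      case False
      hence "v (- A) < v (A + B)" using ge by simp
      hence "l B = l (- A)" using add_lower(2)[of "- A" "A + B"] assms by simp
      hence "M dvd int (l B) - int (l A)" using l_minus[OF assms(1)] by simp
      hence "M dvd (int (v A) - int (v (A + B))) * - (int (l B) - int (l A))" by (meson dvd_minus_iff dvd_mult)
      thus ?thesis using 3 by (simp add: algebra_simps)
    qed
  qed
qed

end

section \<open>Integer polynomials\<close>

definition int_eval :: "'a::field_char_0 \<Rightarrow> int poly \<Rightarrow> 'a" where
  "int_eval x h = poly (map_poly of_int h) x"

lemma int_eval_0 [simp]: "int_eval x 0 = 0"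
  by (simp add: int_eval_def)

lemma int_eval_pCons [simp]: "int_eval x (pCons c h) = of_int c + x * int_eval x h"
  by (simp add: int_eval_def map_poly_pCons)

lemma int_eval_1 [simp]: "int_eval x 1 = 1"
  unfolding one_pCons by simp

lemma int_eval_add [simp]: "int_eval x (g + h) = int_eval x g + int_eval x h"
  by (induction g h rule: poly_induct2) (simp_all add: algebra_simps)

lemma int_eval_smult [simp]: "int_eval x (Polynomial.smult c h) = of_int c * int_eval x h"
  by (induction h) (simp_all add: algebra_simps)

lemma int_eval_minus [simp]: "int_eval x (- h) = - int_eval x h"
  by (induction h) (simp_all add: algebra_simps)

lemma int_eval_diff [simp]: "int_eval x (g - h) = int_eval x g - int_eval x h"
  using int_eval_add[of x g "- h"] by simp

lemma int_eval_mult [simp]: "int_eval x (g * h) = int_eval x g * int_eval x h"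
  by (induction g) (simp_all add: algebra_simps)

lemma int_eval_monom [simp]: "int_eval x (Polynomial.monom c n) = of_int c * x ^ n"
  by (induction n) (simp_all add: Polynomial.monom_0 Polynomial.monom_Suc algebra_simps)

lemma int_eval_sum [simp]: "int_eval x (\<Sum>i\<in>I. h i) = (\<Sum>i\<in>I. int_eval x (h i))"
  by (induction I rule: infinite_finite_induct) simp_all

lemma int_eval_of_int: "int_eval (of_int a) h = of_int (poly h a)"
  by (induction h) simp_all

text \<open>
  A nonzero polynomial \<open>d\<close> of least degree in the ideal \<open>(h, f)\<close> divides both generators up to integer
  factors, by pseudo-division. If \<open>f\<close> divided \<open>d\<close>, it would divide \<open>h\<close>; so \<open>f\<close> divides the cofactor
  of \<open>d\<close> in a multiple of \<open>f\<close>, and \<open>d\<close> is a constant.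
\<close>

lemma prime_int_poly_bezout:
  fixes f h :: "int poly"
  assumes "Factorial_Ring.prime_elem f" "\<not> f dvd h" "Polynomial.degree f > 0"
  obtains s t c where "c \<noteq> 0" "s * h + t * f = [:c:]"
proof -
  have f0: "f \<noteq> 0" using assms(3) by auto
  define P where "P d \<longleftrightarrow> d \<noteq> 0 \<and> (\<exists>s t. d = s * h + t * f)" for d
  have "f = 0 * h + 1 * f" by simp
  hence "P f" unfolding P_def using f0 by blast
  then obtain d where d: "P d" and least: "\<And>e. P e \<Longrightarrow> Polynomial.degree d \<le> Polynomial.degree e"
    using ex_has_least_nat[of P f Polynomial.degree] by blast
  from d obtain s t where d0: "d \<noteq> 0" and st: "d = s * h + t * f" unfolding P_def by blast
  have dvd: "\<exists>a. a \<noteq> 0 \<and> d dvd Polynomial.smult a k" if k: "k = s' * h + t' * f" for k s' t'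
  proof -
    obtain a b where a: "a \<noteq> 0" and eq: "Polynomial.smult a k = d * b + pseudo_mod k d"
      using pseudo_mod(1)[OF d0] by blast
    have "pseudo_mod k d = Polynomial.smult a k - d * b" using eq by simp
    also have "\<dots> = ([:a:] * s' - s * b) * h + ([:a:] * t' - t * b) * f"
      unfolding st k by (simp add: algebra_simps smult_add_right)
    finally have "pseudo_mod k d = 0"
      using pseudo_mod(2)[OF d0, of k] least[of "pseudo_mod k d"] unfolding P_def by (metis not_le)
    thus ?thesis using a eq by auto
  qed
  obtain a where a: "a \<noteq> 0" "d dvd Polynomial.smult a f" using dvd[of f 0 1] by auto
  obtain b where b: "b \<noteq> 0" "d dvd Polynomial.smult b h" using dvd[of h 1 0] by auto
  have no_const: "\<not> f dvd [:c:]" if "c \<noteq> 0" for c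
    using assms(3) that by (auto dest: dvd_imp_degree_le)
  have "\<not> f dvd d"
  proof
    assume "f dvd d"
    hence "f dvd Polynomial.smult b h" using b(2) by (rule dvd_trans)
    hence "f dvd [:b:] * h" by simp
    thus False
      using assms(1,2) no_const[OF b(1)] prime_elem_dvd_mult_iff[of f "[:b:]" h] by blast
  qed
  moreover obtain e where e: "Polynomial.smult a f = d * e" using a(2) by blast
  moreover have "f dvd d * e" unfolding e[symmetric] by (simp add: dvd_smult)
  ultimately have "f dvd e" using assms(1) by (auto simp: prime_elem_dvd_mult_iff)
  then obtain e' where "e = f * e'" by blast
  hence "f * [:a:] = f * (d * e')" using e by (simp add: algebra_simps)
  hence "[:a:] = d * e'" using mult_left_cancel[OF f0] by blast
  hence "Polynomial.degree (d * e') = 0" by (metis degree_pCons_0)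
  hence "Polynomial.degree d = 0" using \<open>[:a:] = d * e'\<close> a(1) d0
    by (metis add_eq_0_iff_both_eq_0 degree_mult_eq mult_zero_right pCons_eq_0_iff)
  then obtain c where "d = [:c:]" by (rule degree_eq_zeroE)
  thus ?thesis using that[of c s t] st d0 by auto
qed

lemma poly_taylor_dvd:
  fixes P :: "int poly"
  shows "y\<^sup>2 dvd poly P (x + y) - poly P x - y * poly (pderiv P) x"
proof (induction P)
  case (pCons c P)
  obtain k where k: "poly P (x + y) - poly P x - y * poly (pderiv P) x = y\<^sup>2 * k"
    using pCons by blast
  have "poly (pCons c P) (x + y) - poly (pCons c P) x - y * poly (pderiv (pCons c P)) x
     = (x + y) * (poly P (x + y) - poly P x - y * poly (pderiv P) x) + y\<^sup>2 * poly (pderiv P) x"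
    by (simp add: pderiv_pCons algebra_simps power2_eq_square)
  also have "\<dots> = y\<^sup>2 * ((x + y) * k + poly (pderiv P) x)" unfolding k by (simp add: algebra_simps)
  finally show ?case by simp
qed simp

section \<open>The trinomial and its irreducibility\<close>

text \<open>
  Up to sign the constant coefficient is the leading coefficient times the product of the complex
  roots.
\<close>

lemma constant_coeff_gt_1:
  fixes g :: "int poly"
  assumes "Polynomial.degree g > 0"
    and roots: "\<And>z :: complex. int_eval z g = 0 \<Longrightarrow> norm z > 1"
  shows "\<bar>poly g 0\<bar> > 1"
proof -
  define G where "G = map_poly complex_of_int g"
  have lc: "Polynomial.lead_coeff G = of_int (Polynomial.lead_coeff g)"
    unfolding G_def by (simp add: coeff_map_poly degree_map_poly)
  have g0: "g \<noteq> 0" using assms(1) by auto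
  have deg: "Polynomial.degree G > 0" using assms(1) by (simp add: G_def degree_map_poly)
  hence G0: "G \<noteq> 0" by auto
  define Z where "Z = {z. poly G z = 0}"
  have "Z \<noteq> {}"
    using fundamental_theorem_of_algebra[of G] deg unfolding Z_def
    by (auto simp: constant_degree)
  have "finite Z" unfolding Z_def using G0 by (rule poly_roots_finite)
  have big: "norm z > 1" if "z \<in> Z" for z
    using that roots[of z] by (simp add: Z_def G_def int_eval_def)
  have "poly G 0 = of_int (Polynomial.lead_coeff g) * (\<Prod>z\<in>Z. (- z) ^ Polynomial.order z G)"
    by (subst complex_poly_decompose[of G, symmetric]) (simp add: lc poly_prod Z_def)
  hence "norm (poly G 0) = \<bar>of_int (Polynomial.lead_coeff g)\<bar> * (\<Prod>z\<in>Z. norm z ^ Polynomial.order z G)"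
    by (simp add: norm_mult norm_power flip: prod_norm)
  moreover have "1 < (\<Prod>z\<in>Z. norm z ^ Polynomial.order z G)"
  proof (rule less_1_prod[OF \<open>finite Z\<close> \<open>Z \<noteq> {}\<close>])
    fix z assume "z \<in> Z"
    hence "Polynomial.order z G > 0" using G0 order_root[of G z] by (auto simp: Z_def)
    thus "1 < norm z ^ Polynomial.order z G" using big[OF \<open>z \<in> Z\<close>] by (simp add: one_less_power)
  qed
  moreover have "1 \<le> \<bar>real_of_int (Polynomial.lead_coeff g)\<bar>"
    using g0 leading_coeff_0_iff[of g] by linarith
  ultimately have "norm (poly G 0) > 1"
    using mult_le_cancel_right1[of "\<Prod>z\<in>Z. norm z ^ Polynomial.order z G"
        "\<bar>real_of_int (Polynomial.lead_coeff g)\<bar>"] by linarith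
  moreover have "poly G 0 = of_int (poly g 0)"
    using int_eval_of_int[of 0 g, where ?'a = complex] by (simp add: int_eval_def G_def)
  ultimately show ?thesis by (metis norm_of_int of_int_1_less_iff of_int_abs)
qed

definition trinomial :: "nat \<Rightarrow> int poly" where
  "trinomial p = Polynomial.monom 1 p + Polynomial.monom 1 (p - 1) + [:2:]"

text \<open>
  In the closed unit disc \<open>z\<^sup>p\<^sup>-\<^sup>1 (z + 1) = -2\<close> forces \<open>\<bar>z + 1\<bar> \<ge> 2\<close>, hence \<open>z = 1\<close>, which is not a
  root.
\<close>

lemma trinomial_root_norm:
  fixes z :: complex
  assumes "p > 0" "int_eval z (trinomial p) = 0"
  shows "norm z > 1"
proof (rule ccontr)
  assume "\<not> norm z > 1"
  hence z: "norm z \<le> 1" by simp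
  obtain k where k: "p = Suc k" using assms(1) gr0_implies_Suc by blast
  have eq: "z ^ k * (z + 1) = - 2"
    using assms(2) by (simp add: trinomial_def k algebra_simps add_eq_0_iff)
  have "norm (z ^ k) \<le> 1" using z by (simp add: norm_power power_le_one)
  moreover have "norm (z ^ k) * norm (z + 1) = 2"
    using arg_cong[OF eq, of norm] by (simp add: norm_mult)
  ultimately have "2 \<le> norm (z + 1)" by (smt (verit) mult_left_le_one_le norm_ge_zero)
  hence "4 \<le> (norm (z + 1))\<^sup>2" using power_mono[of 2 "norm (z + 1)" 2] by simp
  hence "4 \<le> (Re z)\<^sup>2 + (Im z)\<^sup>2 + 2 * Re z + 1"
    unfolding cmod_power2 by (simp add: power2_eq_square algebra_simps)
  moreover have "(Re z)\<^sup>2 + (Im z)\<^sup>2 \<le> 1" using z by (simp add: cmod_def)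
  ultimately have "Re z \<ge> 1" by simp
  hence "(Re z)\<^sup>2 \<ge> 1" by (rule one_le_power)
  hence "(Im z)\<^sup>2 = 0" "(Re z)\<^sup>2 = 1"
    using \<open>(Re z)\<^sup>2 + (Im z)\<^sup>2 \<le> 1\<close> zero_le_power2[of "Im z"] by linarith+
  hence "Im z = 0" "Re z = 1" using \<open>Re z \<ge> 1\<close> by (auto simp: power2_eq_1_iff)
  hence "z = 1" by (simp add: complex_eq_iff)
  thus False using eq by simp
qed

lemma degree_trinomial: "p > 0 \<Longrightarrow> Polynomial.degree (trinomial p) = p"
  and lead_coeff_trinomial: "p > 0 \<Longrightarrow> Polynomial.coeff (trinomial p) p = 1"
proof -
  assume p: "p > 0"
  show c: "Polynomial.coeff (trinomial p) p = 1" using p by (auto simp: trinomial_def coeff_pCons split: nat.splits)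
  show "Polynomial.degree (trinomial p) = p"
  proof (rule antisym)
    show "Polynomial.degree (trinomial p) \<le> p"
      unfolding trinomial_def using p by (intro degree_add_le) (auto intro: order_trans[OF degree_monom_le])
  qed (use c in \<open>auto intro: le_degree\<close>)
qed

text \<open>
  Both factors of a proper factorization would have a constant coefficient of modulus at least 2,
  but the product of these coefficients is 2.
\<close>

lemma prime_elem_trinomial:
  assumes "p > 1"
  shows "Factorial_Ring.prime_elem (trinomial p)"
proof -
  have p: "p > 0" using assms by simp
  have "Factorial_Ring.irreducible (trinomial p)"
  proof (rule Factorial_Ring.irreducibleI)
    show "trinomial p \<noteq> 0" using degree_trinomial[OF p] p by auto
    show "\<not> is_unit (trinomial p)" using degree_trinomial[OF p] p by (auto simp: is_unit_poly_iff)
  next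
    fix g h assume gh: "trinomial p = g * h"
    have lc: "Polynomial.lead_coeff g * Polynomial.lead_coeff h = 1"
      using lead_coeff_mult[of g h] lead_coeff_trinomial[OF p] degree_trinomial[OF p] unfolding gh by simp
    have unit: "is_unit k" if "Polynomial.degree k = 0" "is_unit (Polynomial.lead_coeff k)" for k :: "int poly"
      using that by (auto elim!: degree_eq_zeroE simp: is_unit_const_poly_iff)
    have big: "\<bar>poly k 0\<bar> > 1" if "Polynomial.degree k > 0" "k dvd trinomial p" for k
      using that trinomial_root_norm[OF p] by (intro constant_coeff_gt_1) (auto elim!: dvdE)
    have "poly g 0 * poly h 0 = 2"
      using assms by (simp flip: poly_mult gh add: trinomial_def poly_monom zero_power)
    hence "\<bar>poly g 0\<bar> * \<bar>poly h 0\<bar> = 2" by (simp flip: abs_mult)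
    hence "\<not> (\<bar>poly g 0\<bar> > 1 \<and> \<bar>poly h 0\<bar> > 1)"
      using mult_mono[of 2 "\<bar>poly g 0\<bar>" 2 "\<bar>poly h 0\<bar>"] by auto
    hence "Polynomial.degree g = 0 \<or> Polynomial.degree h = 0"
      using big[of g] big[of h] gh by (metis dvd_triv_left dvd_triv_right gr0I)
    thus "is_unit g \<or> is_unit h" using unit lc by (metis dvd_triv_left dvd_triv_right)
  qed
  thus ?thesis by (rule irreducible_imp_prime_elem)
qed

text \<open>
  As \<open>\<Phi>\<^sub>p\<close> divides \<open>x\<^sup>p - 1\<close>, this relates it to \<open>3 x + 1\<close> at a root of the trinomial: where
  \<open>\<Phi>\<^sub>p(\<alpha>)\<close> has positive valuation, \<open>\<alpha>\<close> reduces to \<open>-1/3\<close>.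
\<close>

lemma trinomial_times_self:
  fixes x :: "'a::field_char_0"
  assumes "p > 0"
  shows "x * int_eval x (trinomial p) = (x ^ p - 1) * (x + 1) + (3 * x + 1)"
  using assms by (cases p) (simp_all add: trinomial_def algebra_simps)

lemma poly_trinomial_times_self:
  fixes a :: int
  assumes "p > 0"
  shows "a * poly (trinomial p) a = (a ^ p - 1) * (a + 1) + (3 * a + 1)"
  using assms by (cases p) (simp_all add: trinomial_def poly_monom algebra_simps)

section \<open>The ring operations of a simple extension\<close>

lemma rat_adjoin_elem:
  assumes "x \<in> carrier (rat_adjoin \<alpha>)"
  obtains g h where "int_eval \<alpha> h \<noteq> 0" "x = int_eval \<alpha> g / int_eval \<alpha> h"
proof -
  interpret K: field "ring_of_type_algebra :: 'a ring" by (rule field_from_type_algebra)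
  have ops: "\<zero>\<^bsub>ring_of_type_algebra\<^esub> = (0 :: 'a)" "\<one>\<^bsub>ring_of_type_algebra\<^esub> = (1 :: 'a)"
    "x \<oplus>\<^bsub>ring_of_type_algebra\<^esub> y = x + y" "x \<otimes>\<^bsub>ring_of_type_algebra\<^esub> y = x * y" for x y :: 'a
    by (simp_all add: ring_of_type_algebra_def)
  have neg: "\<ominus>\<^bsub>ring_of_type_algebra\<^esub> x = - x" for x :: 'a
    by (rule K.minus_equality) (simp_all add: ring_of_type_algebra_def)
  have inv: "inv\<^bsub>ring_of_type_algebra\<^esub> x = inverse x" if "x \<noteq> 0" for x :: 'a
    by (rule K.comm_inv_char) (use that in \<open>simp_all add: ring_of_type_algebra_def\<close>)
  have "x \<in> generate_field ring_of_type_algebra {\<alpha>}" using assms by (simp add: rat_adjoin_def)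
  hence "\<exists>g h. int_eval \<alpha> h \<noteq> 0 \<and> x = int_eval \<alpha> g / int_eval \<alpha> h"
  proof induction
    case one
    show ?case by (intro exI[of _ 1]) (simp add: ops)
  next
    case (incl x)
    thus ?case by (intro exI[of _ "[:0, 1:]"] exI[of _ 1]) simp
  next
    case (a_inv x)
    then obtain g h where "int_eval \<alpha> h \<noteq> 0" "x = int_eval \<alpha> g / int_eval \<alpha> h" by blast
    thus ?case by (intro exI[of _ "- g"] exI[of _ h]) (simp add: neg)
  next
    case (m_inv x)
    then obtain g h where "int_eval \<alpha> h \<noteq> 0" "x = int_eval \<alpha> g / int_eval \<alpha> h" by blast
    thus ?case using m_inv(2) by (intro exI[of _ h] exI[of _ g]) (auto simp: inv ops)
  next
    case (eng_add x y)
    then obtain g h g' h' where "int_eval \<alpha> h \<noteq> 0" "x = int_eval \<alpha> g / int_eval \<alpha> h"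
      "int_eval \<alpha> h' \<noteq> 0" "y = int_eval \<alpha> g' / int_eval \<alpha> h'" by blast
    thus ?case by (intro exI[of _ "g * h' + g' * h"] exI[of _ "h * h'"]) (simp add: ops add_frac_eq)
  next
    case (eng_mult x y)
    then obtain g h g' h' where "int_eval \<alpha> h \<noteq> 0" "x = int_eval \<alpha> g / int_eval \<alpha> h"
      "int_eval \<alpha> h' \<noteq> 0" "y = int_eval \<alpha> g' / int_eval \<alpha> h'" by blast
    thus ?case by (intro exI[of _ "g * g'"] exI[of _ "h * h'"]) (simp add: ops)
  qed
  thus ?thesis using that by blast
qed

lemma rat_adjoin_ops:
  "\<zero>\<^bsub>rat_adjoin \<alpha>\<^esub> = 0" "\<one>\<^bsub>rat_adjoin \<alpha>\<^esub> = 1"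
  "x \<oplus>\<^bsub>rat_adjoin \<alpha>\<^esub> y = x + y" "x \<otimes>\<^bsub>rat_adjoin \<alpha>\<^esub> y = x * y"
  "x [^]\<^bsub>rat_adjoin \<alpha>\<^esub> (n :: nat) = x ^ n"
proof -
  show *: "\<zero>\<^bsub>rat_adjoin \<alpha>\<^esub> = 0" "\<one>\<^bsub>rat_adjoin \<alpha>\<^esub> = 1"
    "x \<oplus>\<^bsub>rat_adjoin \<alpha>\<^esub> y = x + y" "x \<otimes>\<^bsub>rat_adjoin \<alpha>\<^esub> y = x * y" for x y
    by (simp_all add: rat_adjoin_def ring_of_type_algebra_def)
  interpret field "rat_adjoin \<alpha>" by (rule field_rat_adjoin)
  show "x [^]\<^bsub>rat_adjoin \<alpha>\<^esub> n = x ^ n"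
    by (induction n) (simp_all add: * mult.commute)
qed

lemma rat_adjoin_generator: "\<alpha> \<in> carrier (rat_adjoin \<alpha>)"
  by (simp add: rat_adjoin_def generate_field.incl)

lemma rat_adjoin_uminus:
  assumes "x \<in> carrier (rat_adjoin \<alpha>)"
  shows "\<ominus>\<^bsub>rat_adjoin \<alpha>\<^esub> x = - x"
proof -
  interpret field "rat_adjoin \<alpha>" by (rule field_rat_adjoin)
  have "\<ominus>\<^bsub>rat_adjoin \<alpha>\<^esub> x + x = 0" using l_neg[OF assms] by (simp add: rat_adjoin_ops)
  thus ?thesis by (simp add: eq_neg_iff_add_eq_0)
qed

section \<open>A prime at which the trinomial has an approximate root\<close>

lemma three_power_plus_one_mod_8: "odd p \<Longrightarrow> (3 ^ p + 1 :: nat) mod 8 = 4"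
proof (elim oddE)
  fix k assume p: "p = 2 * k + 1"
  have "(9 :: nat) ^ k mod 8 = (9 mod 8) ^ k mod 8" by (rule power_mod[symmetric])
  hence 9: "(9 :: nat) ^ k mod 8 = 1" by simp
  have "(3 :: nat) ^ p + 1 = 3 * 9 ^ k + 1" by (simp add: p power_mult)
  also have "\<dots> mod 8 = (3 * (9 ^ k mod 8) + 1) mod 8" by (metis mod_add_left_eq mod_mult_right_eq)
  finally show ?thesis by (simp add: 9)
qed

text \<open>
  Any prime factor \<open>q\<close> of the odd number \<open>(3\<^sup>p + 1) / 4\<close> will do. The power \<open>q\<^sup>p \<ge> 3\<^sup>p\<close> is too large
  to divide it. Modulo \<open>q\<close> the number 9 has order \<open>p\<close>, so \<open>p\<close> divides \<open>q - 1\<close>, as does 2.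
\<close>

lemma prime_divisor_three_power_plus_one:
  fixes p :: nat
  assumes "Factorial_Ring.prime p" "p \<ge> 3"
  obtains q where "Factorial_Ring.prime q" "odd q" "q dvd 3 ^ p + 1"
    "\<not> q ^ p dvd 3 ^ p + 1" "2 * p < q"
proof -
  have "odd p" using assms prime_odd_nat by force
  define N :: nat where "N = (3 ^ p + 1) div 4"
  have m8: "(3 ^ p + 1 :: nat) mod 8 = 4" by (rule three_power_plus_one_mod_8[OF \<open>odd p\<close>])
  hence N: "3 ^ p + 1 = 4 * N" and "odd N"
  proof -
    have "x = 4 * (x div 4) \<and> odd (x div 4)" if "x mod 8 = 4" for x :: nat using that by presburger
    from this[OF m8] show "3 ^ p + 1 = 4 * N" "odd N" unfolding N_def by blast+
  qed
  have "(3 :: nat) ^ 3 \<le> 3 ^ p" using assms(2) by (intro power_increasing) auto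
  hence "N > 1" using N by simp
  then obtain q where q: "Factorial_Ring.prime q" "q dvd N" using prime_factor_nat[of N] by auto
  have "odd q" using q(2) \<open>odd N\<close> by (meson dvd_trans)
  have qd: "q dvd 3 ^ p + 1" using q(2) N by simp
  have q3: "q \<ge> 3" using \<open>odd q\<close> prime_ge_2_nat[OF q(1)] by (cases "q = 2") auto
  have qp: "\<not> q ^ p dvd 3 ^ p + 1"
  proof
    assume "q ^ p dvd 3 ^ p + 1"
    moreover have "coprime (q ^ p) 4"
      using \<open>odd q\<close> coprime_power_right_iff[of q 2 2] by simp
    ultimately have "q ^ p dvd N" unfolding N by (simp add: coprime_dvd_mult_right_iff)
    hence "q ^ p \<le> N" using \<open>N > 1\<close> by (auto dest: dvd_imp_le)
    moreover have "3 ^ p \<le> q ^ p" using q3 by (rule power_mono) simp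
    ultimately show False using N \<open>N > 1\<close> by linarith
  qed
  \<comment> \<open>It remains to see that 9 has order \<open>p\<close> modulo \<open>q\<close>.\<close>
  have n3: "\<not> q dvd 3"
  proof
    assume "q dvd 3"
    hence "q dvd 3 ^ p" using assms(2) by (meson dvd_power dvd_trans less_le_trans zero_less_numeral)
    hence "q dvd 1" using qd dvd_add_right_iff[of q "3 ^ p" 1] by blast
    thus False using q(1) by simp
  qed
  have cop: "coprime q 9"
    using n3 q(1) prime_dvd_mult_iff[OF q(1), of 3 3] by (intro prime_imp_coprime) auto
  have "int q dvd int (3 ^ p + 1)" using qd by (simp only: of_nat_dvd_iff)
  hence "int q dvd (3 ^ p + 1) * (3 ^ p - 1)" by (intro dvd_mult2) (simp add: add.commute)
  also have "(3 ^ p + 1) * (3 ^ p - 1) = (9 ^ p - 1 :: int)"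
    by (simp add: algebra_simps power_mult_distrib[symmetric])
  finally have "[9 ^ p = 1] (mod int q)" by (simp add: cong_iff_dvd_diff)
  hence "[9 ^ p = 1] (mod q)" using cong_int_iff[of "9 ^ p" 1 q] by simp
  hence "ord q 9 dvd p" by (simp only: ord_divides)
  moreover have "ord q 9 \<noteq> 1"
  proof
    assume "ord q 9 = 1"
    hence "[9 ^ 1 = 1] (mod q)" unfolding ord_divides by simp
    hence "q dvd 2 ^ 3" using cong_altdef_nat[of 1 9 q] by (simp add: cong_sym_eq)
    hence "q dvd 2" using q(1) by (rule prime_dvd_power[rotated])
    thus False using \<open>odd q\<close> q(1) by (metis primes_dvd_imp_eq two_is_prime_nat dvd_refl)
  qed
  ultimately have "ord q 9 = p" using assms(1) by (auto simp: prime_nat_iff)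
  hence "p dvd q - 1" using order_divides_totient[OF cop] q(1) by (simp add: totient_prime)
  moreover have "2 dvd q - 1" using \<open>odd q\<close> by simp
  moreover have "coprime 2 p" using \<open>odd p\<close> by simp
  ultimately have "2 * p dvd q - 1" by (simp add: divides_mult)
  hence "2 * p < q" using q3 by (auto dest: dvd_imp_le)
  thus ?thesis using that q(1) \<open>odd q\<close> qd qp by blast
qed

text \<open>
  At a prime \<open>q\<close> as above, \<open>-1/3\<close> is a root of the trinomial modulo \<open>q\<close>. The bound \<open>2 p < q\<close> makes
  it a simple root, because the derivative there is a unit times \<open>2 p - 3\<close>; so it lifts to a
  \<open>q\<close>-adic root. The number \<open>e\<close> turns out to be the valuation of \<open>\<Phi>\<^sub>p\<close> at this root.
\<close>

locale trinomial_place = odd_prime_primroot +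
  fixes p :: nat
  assumes p_prime: "Factorial_Ring.prime p" and p_ge_3: "p \<ge> 3"
    and q_dvd: "int q dvd 3 ^ p + 1" and q_power: "\<not> int q ^ p dvd 3 ^ p + 1"
    and q_gt: "2 * p < q"
begin

lemma p_odd: "odd p"
  using p_prime p_ge_3 prime_odd_nat by force

abbreviation e :: nat where "e \<equiv> v (3 ^ p + 1)"

abbreviation f :: "int poly" where "f \<equiv> trinomial p"

lemma not_dvd_small: "0 < \<bar>m\<bar> \<Longrightarrow> \<bar>m\<bar> < int q \<Longrightarrow> \<not> int q dvd m"
  by (auto dest: dvd_imp_le_int)

lemma not_dvd_2_4: "\<not> int q dvd 2" "\<not> int q dvd 4"
  by (rule not_dvd_small; use q_gt p_ge_3 in simp)+

lemma residue_units:
  assumes "int q dvd 3 * a + 1"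
  shows "\<not> int q dvd a" "\<not> int q dvd a - 1" "\<not> int q dvd a + 1"
proof -
  have a: "int q dvd (3 * a + 1) - 3 * b" if "int q dvd b" for b
    using assms that by (intro dvd_diff) auto
  show "\<not> int q dvd a"
    using a[of a] prime_int by auto
  show "\<not> int q dvd a - 1"
    using a[of "a - 1"] not_dvd_2_4 by (auto simp: algebra_simps)
  show "\<not> int q dvd a + 1"
    using a[of "a + 1"] not_dvd_2_4 by (auto simp: algebra_simps)
qed

lemma residue_power:
  assumes "int q dvd 3 * a + 1"
  shows "[a ^ p = 1] (mod int q)"
proof -
  have "[3 * a = - 1] (mod int q)" using assms by (simp add: cong_iff_dvd_diff)
  hence "[(3 * a) ^ p = (- 1) ^ p] (mod int q)" by (rule cong_pow)
  hence 1: "int q dvd 3 ^ p * a ^ p + 1" using p_odd by (simp add: cong_iff_dvd_diff power_mult_distrib)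
  have "int q dvd (3 ^ p + 1) * a ^ p - (3 ^ p * a ^ p + 1)" using q_dvd 1 by (intro dvd_diff) auto
  thus ?thesis by (simp add: cong_iff_dvd_diff algebra_simps)
qed

lemma p_pos: "p > 0"
  using p_ge_3 by simp

lemma derivative_unit:
  assumes "int q dvd 3 * a + 1"
  shows "\<not> int q dvd poly (pderiv f) a"
proof
  define k where "k = p - 2"
  have k: "p = Suc (Suc k)" using p_ge_3 by (simp add: k_def)
  assume "int q dvd poly (pderiv f) a"
  hence "int q dvd 3 * poly (pderiv f) a - int p * a ^ k * (3 * a + 1)"
    using assms by (intro dvd_diff) auto
  also have "3 * poly (pderiv f) a - int p * a ^ k * (3 * a + 1) = a ^ k * (2 * int p - 3)"
    by (simp add: trinomial_def pderiv_add pderiv_monom pderiv_pCons poly_monom k algebra_simps)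
  finally have "int q dvd a \<or> int q dvd 2 * int p - 3"
    using prime_dvd_power[OF prime_int] prime_dvd_mult_iff[OF prime_int] by blast
  thus False using residue_units[OF assms] not_dvd_small[of "2 * int p - 3"] q_gt p_ge_3 by auto
qed

lemma residue_exists: "\<exists>a. int q dvd 3 * a + 1"
proof -
  have "\<not> int q dvd 3" using q_gt p_ge_3 by (intro not_dvd_small) auto
  hence "coprime 3 (int q)" using prime_int prime_imp_coprime coprime_commute by blast
  then obtain b where b: "[3 * b = 1] (mod int q)" using cong_solve_coprime_int by blast
  hence "int q dvd 3 * (- b) + 1" by (simp add: cong_iff_dvd_diff dvd_diff_commute)
  thus ?thesis ..
qed

text \<open>
  Hensel's lemma, in the form of one integer for each precision.
\<close>

lemma approximate_root: "\<exists>a. int q dvd 3 * a + 1 \<and> int q ^ n dvd poly f a"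
proof (cases n)
  case 0
  thus ?thesis using residue_exists by simp
next
  case (Suc m)
  have "\<exists>a. int q dvd 3 * a + 1 \<and> int q ^ Suc m dvd poly f a"
  proof (induction m)
    case 0
    obtain a where a: "int q dvd 3 * a + 1" using residue_exists by blast
    have "int q dvd (a ^ p - 1) * (a + 1)"
      using residue_power[OF a] by (simp add: cong_iff_dvd_diff)
    from dvd_add[OF this a] have "int q dvd a * poly f a"
      unfolding poly_trinomial_times_self[OF p_pos] .
    thus ?case using residue_units(1)[OF a] a prime_int by (auto simp: prime_dvd_mult_iff)
  next
    case (Suc m)
    then obtain a where a: "int q dvd 3 * a + 1" "int q ^ Suc m dvd poly f a" by blast
    then obtain c where c: "poly f a = int q ^ Suc m * c" by blast
    have "coprime (poly (pderiv f) a) (int q)"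
      using derivative_unit[OF a(1)] prime_int prime_imp_coprime coprime_commute by blast
    then obtain d where d: "[poly (pderiv f) a * d = 1] (mod int q)" using cong_solve_coprime_int by blast
    \<comment> \<open>The Newton correction: \<open>d\<close> inverts the derivative modulo \<open>q\<close>, so the linear term cancels
      \<open>f(a)\<close> up to one more factor \<open>q\<close>.\<close>
    define y where "y = - (int q ^ Suc m * (d * c))"
    have "y\<^sup>2 dvd poly f (a + y) - poly f a - y * poly (pderiv f) a" by (rule poly_taylor_dvd)
    moreover have "int q ^ Suc (Suc m) dvd y\<^sup>2"
      unfolding y_def power2_eq_square by (auto intro!: dvd_mult2 simp: mult_ac)
    ultimately have 1: "int q ^ Suc (Suc m) dvd poly f (a + y) - poly f a - y * poly (pderiv f) a"
      by (rule dvd_trans[rotated])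
    have "poly f a + y * poly (pderiv f) a = int q ^ Suc m * (c * (1 - poly (pderiv f) a * d))"
      unfolding c y_def by (simp add: algebra_simps)
    moreover have "int q dvd 1 - poly (pderiv f) a * d" using d by (simp add: cong_iff_dvd_diff dvd_diff_commute)
    ultimately have 2: "int q ^ Suc (Suc m) dvd poly f a + y * poly (pderiv f) a"
      by (simp only: power_Suc2[of _ "Suc m"]) (intro mult_dvd_mono dvd_refl dvd_mult)
    have "int q ^ Suc (Suc m) dvd poly f (a + y)" using dvd_add[OF 1 2] by simp
    moreover have "int q dvd (3 * a + 1) + 3 * y"
      by (rule dvd_add[OF a(1)]) (simp add: y_def)
    hence "int q dvd 3 * (a + y) + 1" by (simp add: algebra_simps)
    ultimately show ?case by blast
  qed
  thus ?thesis using Suc by simp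
qed

lemma not_power_dvd: "A \<noteq> 0 \<Longrightarrow> v A < N \<Longrightarrow> \<not> int q ^ N dvd A"
  using prime_int by (metis multiplicity_geI not_le not_prime_unit)

lemma v_unit: "\<not> int q dvd A \<Longrightarrow> v A = 0"
  by (rule not_dvd_imp_multiplicity_0)

lemma three_power_nonzero: "(3 ^ p + 1 :: int) \<noteq> 0"
  using zero_less_power[of "3 :: int" p] by linarith

text \<open>
  Multiplied by \<open>3\<^sup>p\<close>, the trinomial becomes a polynomial in \<open>z = 3 a + 1\<close> with constant term
  \<open>2 (3\<^sup>p + 1)\<close> and linear coefficient \<open>3 - 2 p\<close>, a unit. At an approximate root these two terms
  balance.
\<close>

lemma v_linear:
  assumes "int q dvd 3 * a + 1" "int q ^ N dvd poly f a" "e < N"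
  shows "v (3 * a + 1) = e" "3 * a + 1 \<noteq> 0"
proof -
  define z where "z = 3 * a + 1"
  show z0: "3 * a + 1 \<noteq> 0" by presburger
  define T where "T = Polynomial.monom 1 p + Polynomial.monom 3 (p - 1) + [:2 * 3 ^ p :: int:]"
  define k where "k = p - 2"
  have k: "p = Suc (Suc k)" "odd k" using p_ge_3 p_odd by (auto simp: k_def)
  have T: "poly T (- 1 + z) = 3 ^ p * poly f a" "poly T (- 1) = 2 * (3 ^ p + 1)"
    "poly (pderiv T) (- 1) = 3 - 2 * int p"
    using k by (simp_all add: T_def z_def trinomial_def poly_monom pderiv_add pderiv_monom pderiv_pCons
        algebra_simps power_mult_distrib)
  obtain c where "poly T (- 1 + z) - poly T (- 1) - z * poly (pderiv T) (- 1) = z\<^sup>2 * c"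
    using poly_taylor_dvd[of z T "- 1"] by blast
  hence eq: "z * ((2 * int p - 3) - z * c) = 2 * (3 ^ p + 1) - 3 ^ p * poly f a"
    unfolding T by (simp add: algebra_simps power2_eq_square)
  have ve: "v (2 * (3 ^ p + 1)) = e" using v_mult[OF _ three_power_nonzero, of 2] v_unit[OF not_dvd_2_4(1)] by simp
  have "v (2 * (3 ^ p + 1) - 3 ^ p * poly f a) = e"
    using close(2)[of N "2 * (3 ^ p + 1)" "2 * (3 ^ p + 1) - 3 ^ p * poly f a"]
      not_power_dvd[of "2 * (3 ^ p + 1)" N] three_power_nonzero assms ve by simp
  moreover have u: "\<not> int q dvd (2 * int p - 3) - z * c"
  proof
    assume "int q dvd (2 * int p - 3) - z * c"
    hence "int q dvd (2 * int p - 3) - z * c + z * c" using assms(1) unfolding z_def by (intro dvd_add[OF _ dvd_mult2])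
    thus False using not_dvd_small[of "2 * int p - 3"] q_gt p_ge_3 by auto
  qed
  moreover have "v (z * ((2 * int p - 3) - z * c)) = v z + 0"
    using z0 u by (subst v_mult) (auto simp: z_def v_unit)
  ultimately have "v z = e" unfolding eq by linarith
  thus "v (3 * a + 1) = e" unfolding z_def .
qed

text \<open>
  At the root, \<open>\<Phi>\<^sub>p(a) (a - 1)(a + 1) = -(3 a + 1)\<close>, and \<open>a - 1\<close>, \<open>a + 1\<close> are units.
\<close>

lemma v_cyclotomic:
  assumes "int q dvd 3 * a + 1" "int q ^ N dvd poly f a" "e < N"
  shows "v (\<Sum>i<p. a ^ i) = e"
proof -
  note lin = v_linear[OF assms]
  have eq: "(\<Sum>i<p. a ^ i) * ((a - 1) * (a + 1)) = a * poly f a - (3 * a + 1)"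
    using power_diff_1_eq[of a p] by (simp add: poly_trinomial_times_self[OF p_pos] mult_ac)
  have "v (a * poly f a - (3 * a + 1)) = v (- (3 * a + 1))"
  proof (rule close(2))
    show "\<not> int q ^ N dvd - (3 * a + 1)"
      unfolding dvd_minus_iff using lin assms(3) by (intro not_power_dvd) simp_all
    have "int q ^ N dvd - (a * poly f a)" using assms(2) by simp
    thus "int q ^ N dvd - (3 * a + 1) - (a * poly f a - (3 * a + 1))" by simp
  qed
  also have "\<dots> = e" using lin by (simp only: multiplicity_uminus_right)
  finally have 1: "v ((\<Sum>i<p. a ^ i) * ((a - 1) * (a + 1))) = e" unfolding eq .
  have u: "\<not> int q dvd (a - 1) * (a + 1)" by (intro not_dvd_mult residue_units assms(1))
  have "(\<Sum>i<p. a ^ i) \<noteq> 0"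
  proof
    assume "(\<Sum>i<p. a ^ i) = 0"
    hence "int q ^ N dvd 3 * a + 1" using eq assms(2) by (metis dvd_mult eq_iff_diff_eq_0 mult_zero_left)
    thus False using lin assms(3) not_power_dvd by metis
  qed
  hence "v ((\<Sum>i<p. a ^ i) * ((a - 1) * (a + 1))) = v (\<Sum>i<p. a ^ i) + 0"
    using u by (subst v_mult) (auto simp: v_unit)
  thus ?thesis using 1 by simp
qed

lemma e_pos: "e > 0"
  using prime_multiplicity_gt_zero_iff[of "int q" "3 ^ p + 1"] prime_int three_power_nonzero q_dvd by blast

lemma coprime_e_p: "coprime e p"
proof -
  have "e < p" using q_power multiplicity_dvd'[of p "int q" "3 ^ p + 1"] by (meson not_le)
  thus ?thesis using e_pos p_prime by (metis coprime_commute nat_dvd_not_less prime_imp_coprime)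
qed

text \<open>
  The residue \<open>-1/3\<close> of \<open>a\<close> is a primitive \<open>p\<close>-th root of unity, so \<open>a\<^sup>4\<^sup>e\<close> is not 1, as \<open>p\<close> does
  not divide \<open>4 e\<close>. One factor 2 in this exponent is in the statement, the other one comes from
  \<open>2 M = q - 1\<close>.
\<close>

lemma log_root_not_dvd:
  assumes a: "int q dvd 3 * a + 1"
  shows "\<not> M dvd 2 * (int e * int (l a))"
proof
  assume "M dvd 2 * (int e * int (l a))"
  hence "2 * M dvd 2 * (2 * (int e * int (l a)))" by (rule mult_dvd_mono[OF dvd_refl])
  hence "int q - 1 dvd int (dlog a * (4 * e)) - int 0"
    unfolding two_M using v_unit[OF residue_units(1)[OF a]] by (simp add: angular_log_def algebra_simps)
  hence "[int \<gamma> ^ (dlog a * (4 * e)) = 1] (mod int q)" unfolding gen_power_eq_iff[symmetric] by simp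
  moreover have "[int \<gamma> ^ (dlog a * (4 * e)) = a ^ (4 * e)] (mod int q)"
    unfolding power_mult by (intro cong_pow dlog_spec residue_units(1) a)
  ultimately have 4: "[a ^ (4 * e) = 1] (mod int q)" by (meson cong_sym cong_trans)
  have "coprime (4 * e) p" using coprime_e_p p_odd coprime_power_left_iff[of 2 2 p] by (simp add: coprime_mult_left_iff)
  moreover have "4 * e \<noteq> 0" using e_pos by simp
  ultimately obtain x y where xy: "4 * e * x = p * y + 1"
    using bezout_nat[of "4 * e" p] by (auto simp: coprime_iff_gcd_eq_1)
  have "[a ^ (4 * e * x) = 1] (mod int q)" unfolding power_mult[of a "4 * e" x] using cong_pow[OF 4, of x] by simp
  moreover have "[(a ^ p) ^ y * a = 1 ^ y * a] (mod int q)"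
    by (intro cong_mult cong_pow residue_power a cong_refl)
  hence "[a ^ (p * y + 1) = a] (mod int q)" by (simp add: power_mult mult.commute)
  ultimately have "[a = 1] (mod int q)" unfolding xy by (meson cong_sym cong_trans)
  thus False using residue_units(2)[OF a] by (simp add: cong_iff_dvd_diff)
qed

end

section \<open>The tame symbol at the approximate root\<close>

text \<open>
  The \<open>q\<close>-adic place of \<open>\<rat>(\<alpha>)\<close> is represented by approximations: \<open>\<alpha>\<close> is replaced by the integer
  \<open>approx n\<close>, and an element of the field by the rational number obtained from a fixed way of writing
  it as a fraction in \<open>\<alpha>\<close>. For each \<open>n\<close> this gives a valuation \<open>val n\<close> and the logarithm \<open>ang n\<close> of a leading digit,
  whose laws hold for all large \<open>n\<close>, the bound depending on the elements involved.
\<close>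

locale trinomial_completion = trinomial_place +
  fixes \<alpha> :: "'a::field_char_0" and approx :: "nat \<Rightarrow> int"
  assumes root: "int_eval \<alpha> f = 0"
    and approx_residue: "int q dvd 3 * approx n + 1"
    and approx_root: "int q ^ n dvd poly f (approx n)"
begin

abbreviation at_approx :: "int poly \<Rightarrow> nat \<Rightarrow> int" where "at_approx h n \<equiv> poly h (approx n)"

lemma bezout_trinomial:
  assumes "\<not> f dvd h"
  obtains s t c where "c \<noteq> 0" "s * h + t * f = [:c:]"
proof -
  have "Factorial_Ring.prime_elem f" using p_ge_3 by (intro prime_elem_trinomial) simp
  moreover have "Polynomial.degree f > 0" using degree_trinomial[OF p_pos] p_pos by simp
  ultimately show ?thesis using prime_int_poly_bezout[OF _ assms] that by metis
qed

lemma vanishing_imp_dvd: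
  assumes "int_eval \<alpha> h = 0"
  shows "f dvd h"
proof (rule ccontr)
  assume "\<not> f dvd h"
  then obtain s t c where c: "c \<noteq> 0" "s * h + t * f = [:c:]" by (rule bezout_trinomial)
  have "int_eval \<alpha> (s * h + t * f) = 0" using assms root by simp
  thus False using c by simp
qed

lemma vanishing_imp_small:
  assumes "int_eval \<alpha> h = 0"
  shows "\<forall>\<^sub>F n in sequentially. int q ^ N dvd at_approx h n"
proof (rule eventually_sequentiallyI)
  fix n assume "N \<le> n"
  obtain t where "h = f * t" using vanishing_imp_dvd[OF assms] by blast
  hence "int q ^ n dvd at_approx h n" using approx_root[of n] by simp
  thus "int q ^ N dvd at_approx h n" using \<open>N \<le> n\<close> by (meson dvd_trans le_imp_power_dvd)
qed

text \<open>
  The integer \<open>c\<close> in a Bezout identity for \<open>h\<close> and \<open>f\<close> bounds the valuations.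
\<close>

lemma nonvanishing_bounded:
  assumes "int_eval \<alpha> h \<noteq> 0"
  shows "\<exists>N. \<forall>\<^sub>F n in sequentially. \<not> int q ^ N dvd at_approx h n"
proof -
  have "\<not> f dvd h" using assms root by (auto elim!: dvdE)
  then obtain s t c where c: "c \<noteq> 0" "s * h + t * f = [:c:]" by (rule bezout_trinomial)
  define N where "N = Suc (v c)"
  have "\<not> int q ^ N dvd at_approx h n" if "N \<le> n" for n
  proof
    assume "int q ^ N dvd at_approx h n"
    moreover have "int q ^ N dvd at_approx f n"
      using approx_root[of n] that by (meson dvd_trans le_imp_power_dvd)
    ultimately have "int q ^ N dvd at_approx (s * h + t * f) n" by simp
    hence "int q ^ N dvd c" unfolding c by simp
    thus False using not_power_dvd[OF c(1), of N] by (simp add: N_def)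
  qed
  thus ?thesis unfolding eventually_sequentially by blast
qed

text \<open>
  The approximate valuation and leading digit of a polynomial expression in \<open>\<alpha>\<close> depend, for large
  \<open>n\<close>, on the value of the expression only: the difference of two representing polynomials tends
  to 0, while a nonzero value keeps away from 0.
\<close>

lemma eventually_same:
  assumes "int_eval \<alpha> g = int_eval \<alpha> h" "int_eval \<alpha> h \<noteq> 0"
  shows "\<forall>\<^sub>F n in sequentially. at_approx g n \<noteq> 0 \<and> at_approx h n \<noteq> 0 \<and>
    v (at_approx g n) = v (at_approx h n) \<and> l (at_approx g n) = l (at_approx h n)"
proof -
  obtain N where N: "\<forall>\<^sub>F n in sequentially. \<not> int q ^ N dvd at_approx h n"
    using nonvanishing_bounded[OF assms(2)] by blast
  have "int_eval \<alpha> (h - g) = 0" using assms(1) by simp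
  from vanishing_imp_small[OF this, of N] N show ?thesis
  proof eventually_elim
    case (elim n)
    thus ?case using close[of N "at_approx h n" "at_approx g n"] by auto
  qed
qed

definition fraction :: "'a \<Rightarrow> int poly \<times> int poly" where
  "fraction x = (SOME (g, h). int_eval \<alpha> h \<noteq> 0 \<and> x = int_eval \<alpha> g / int_eval \<alpha> h)"

abbreviation num where "num x \<equiv> fst (fraction x)"
abbreviation den where "den x \<equiv> snd (fraction x)"

lemma fraction:
  assumes "x \<in> carrier (rat_adjoin \<alpha>)"
  shows "int_eval \<alpha> (den x) \<noteq> 0" "int_eval \<alpha> (num x) = x * int_eval \<alpha> (den x)"
proof -
  obtain g h where "int_eval \<alpha> h \<noteq> 0" "x = int_eval \<alpha> g / int_eval \<alpha> h"
    using assms by (rule rat_adjoin_elem)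
  hence "case (g, h) of (g, h) \<Rightarrow> int_eval \<alpha> h \<noteq> 0 \<and> x = int_eval \<alpha> g / int_eval \<alpha> h" by simp
  hence "\<exists>gh. case gh of (g, h) \<Rightarrow> int_eval \<alpha> h \<noteq> 0 \<and> x = int_eval \<alpha> g / int_eval \<alpha> h" by (rule exI)
  from someI_ex[OF this] have "int_eval \<alpha> (den x) \<noteq> 0 \<and> x = int_eval \<alpha> (num x) / int_eval \<alpha> (den x)"
    unfolding fraction_def[symmetric] by (simp add: case_prod_beta)
  thus "int_eval \<alpha> (den x) \<noteq> 0" "int_eval \<alpha> (num x) = x * int_eval \<alpha> (den x)"
    by (auto simp: field_simps)
qed

definition val :: "nat \<Rightarrow> 'a \<Rightarrow> int" where
  "val n x = int (v (at_approx (num x) n)) - int (v (at_approx (den x) n))"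

definition ang :: "nat \<Rightarrow> 'a \<Rightarrow> int" where
  "ang n x = int (l (at_approx (num x) n)) - int (l (at_approx (den x) n))"

lemma eventually_nonzero:
  assumes "int_eval \<alpha> h \<noteq> 0"
  shows "\<forall>\<^sub>F n in sequentially. at_approx h n \<noteq> 0"
  using eventually_same[OF refl assms] by eventually_elim simp

text \<open>
  Makes the chosen fraction irrelevant: any other one may be used to compute \<open>val\<close> and \<open>ang\<close>.
\<close>

lemma val_ang_eq:
  assumes x: "x \<in> carrier (rat_adjoin \<alpha>)" "x \<noteq> 0"
    and gh: "int_eval \<alpha> g = x * int_eval \<alpha> h" "int_eval \<alpha> h \<noteq> 0"
  shows "\<forall>\<^sub>F n in sequentially.
    val n x = int (v (at_approx g n)) - int (v (at_approx h n)) \<and>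
    M dvd ang n x - (int (l (at_approx g n)) - int (l (at_approx h n)))"
proof -
  note frac = fraction[OF x(1)]
  have eq: "int_eval \<alpha> (num x * h) = int_eval \<alpha> (g * den x)" using frac gh by simp
  have nz: "int_eval \<alpha> (g * den x) \<noteq> 0" using frac gh x by simp
  show ?thesis
    using eventually_same[OF eq nz]
  proof eventually_elim
    case (elim n)
    let ?N = "at_approx (num x) n" and ?D = "at_approx (den x) n" and ?G = "at_approx g n" and ?H = "at_approx h n"
    have nz: "?N \<noteq> 0" "?D \<noteq> 0" "?G \<noteq> 0" "?H \<noteq> 0" using elim by auto
    have "v ?N + v ?H = v ?G + v ?D" using elim v_mult nz by simp
    moreover have "M dvd (int (l (?G * ?D)) - (int (l ?G) + int (l ?D)))
        - (int (l (?N * ?H)) - (int (l ?N) + int (l ?H)))"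
      by (intro dvd_diff l_mult nz)
    ultimately show ?case using elim by (simp add: val_def ang_def algebra_simps)
  qed
qed

lemma val_ang_mult:
  assumes "x \<in> carrier (rat_adjoin \<alpha>)" "x \<noteq> 0" "y \<in> carrier (rat_adjoin \<alpha>)" "y \<noteq> 0"
  shows "\<forall>\<^sub>F n in sequentially. val n (x * y) = val n x + val n y \<and>
    M dvd ang n (x * y) - (ang n x + ang n y)"
proof -
  interpret F: field "rat_adjoin \<alpha>" by (rule field_rat_adjoin)
  note fx = fraction[OF assms(1)] and fy = fraction[OF assms(3)]
  have xy: "x * y \<in> carrier (rat_adjoin \<alpha>)"
    using F.m_closed[OF assms(1,3)] by (simp add: rat_adjoin_ops)
  have "\<forall>\<^sub>F n in sequentially.
    val n (x * y) = int (v (at_approx (num x * num y) n)) - int (v (at_approx (den x * den y) n)) \<and>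
    M dvd ang n (x * y) - (int (l (at_approx (num x * num y) n)) - int (l (at_approx (den x * den y) n)))"
    by (rule val_ang_eq[OF xy]) (use assms fx fy in \<open>auto simp: algebra_simps\<close>)
  moreover have "\<forall>\<^sub>F n in sequentially. at_approx (num x * num y * (den x * den y)) n \<noteq> 0"
    by (rule eventually_nonzero) (use assms fx fy in auto)
  ultimately show ?thesis
  proof eventually_elim
    case (elim n)
    let ?N = "at_approx (num x) n" and ?D = "at_approx (den x) n"
      and ?N' = "at_approx (num y) n" and ?D' = "at_approx (den y) n"
    have nz: "?N \<noteq> 0" "?D \<noteq> 0" "?N' \<noteq> 0" "?D' \<noteq> 0" using elim(2) by auto
    have "M dvd (int (l (?N * ?N')) - (int (l ?N) + int (l ?N')))
        - (int (l (?D * ?D')) - (int (l ?D) + int (l ?D')))"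
      by (intro dvd_diff l_mult nz)
    from dvd_add[OF conjunct2[OF elim(1)] this]
    have "M dvd ang n (x * y) - (ang n x + ang n y)" by (simp add: ang_def algebra_simps)
    thus ?case using elim(1) nz by (simp add: val_def v_mult)
  qed
qed

text \<open>
  The discrete logarithm of the tame symbol \<open>(-1)\<^bsup>v(x)v(y)\<^esup> x\<^bsup>v(y)\<^esup> / y\<^bsup>v(x)\<^esup>\<close>, modulo \<open>M\<close>.
\<close>

definition tame :: "nat \<Rightarrow> 'a \<times> 'a \<Rightarrow> int" where
  "tame n = (\<lambda>(x, y). val n y * ang n x - val n x * ang n y)"

lemma tame_left:
  assumes "x \<in> carrier (rat_adjoin \<alpha>)" "x \<noteq> 0" "y \<in> carrier (rat_adjoin \<alpha>)" "y \<noteq> 0"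
  shows "\<forall>\<^sub>F n in sequentially. M dvd tame n (x * y, z) - tame n (x, z) - tame n (y, z)"
  using val_ang_mult[OF assms]
proof eventually_elim
  case (elim n)
  hence "M dvd val n z * (ang n (x * y) - (ang n x + ang n y))" by simp
  thus ?case using elim by (simp add: tame_def algebra_simps)
qed

lemma tame_antisym: "tame n (x, y) = - tame n (y, x)"
  by (simp add: tame_def)

lemma tame_right:
  assumes "y \<in> carrier (rat_adjoin \<alpha>)" "y \<noteq> 0" "z \<in> carrier (rat_adjoin \<alpha>)" "z \<noteq> 0"
  shows "\<forall>\<^sub>F n in sequentially. M dvd tame n (x, y * z) - tame n (x, y) - tame n (x, z)"
  using tame_left[OF assms, of x]
proof eventually_elim
  case (elim n)
  have "tame n (x, y * z) - tame n (x, y) - tame n (x, z)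
     = - (tame n (y * z, x) - tame n (y, x) - tame n (z, x))"
    by (simp add: tame_antisym[of n x])
  thus ?case using elim by (simp only: dvd_minus_iff)
qed

lemma tame_steinberg:
  assumes x: "x \<in> carrier (rat_adjoin \<alpha>)" "x \<noteq> 0" and y: "y \<in> carrier (rat_adjoin \<alpha>)" "y \<noteq> 0"
    and sum: "x + y = 1"
  shows "\<forall>\<^sub>F n in sequentially. M dvd tame n (x, y)"
proof -
  note fx = fraction[OF x(1)] and fy = fraction[OF y(1)]
  \<comment> \<open>Fractions over a common denominator, so that integers can be added.\<close>
  define A where "A = num x * den y"
  define B where "B = num y * den x"
  define C where "C = den x * den y"
  have ev: "int_eval \<alpha> A = x * int_eval \<alpha> C" "int_eval \<alpha> B = y * int_eval \<alpha> C" and C: "int_eval \<alpha> C \<noteq> 0"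
    using fx fy by (auto simp: A_def B_def C_def)
  have AB: "int_eval \<alpha> (A + B) = int_eval \<alpha> C"
    using sum by (simp add: ev flip: distrib_right)
  have "int_eval \<alpha> (A * B) \<noteq> 0" using ev C x y by simp
  from eventually_nonzero[OF this] val_ang_eq[OF x ev(1) C] val_ang_eq[OF y ev(2) C] eventually_same[OF AB C]
  show ?thesis
  proof eventually_elim
    case (elim n)
    let ?A = "at_approx A n" and ?B = "at_approx B n" and ?C = "at_approx C n"
    have v: "v (?A + ?B) = v ?C" and l: "l (?A + ?B) = l ?C" using elim by auto
    obtain i where "ang n x - (int (l ?A) - int (l ?C)) = M * i"
      using conjunct2[OF elim(2)] by (rule dvdE)
    moreover obtain j where "ang n y - (int (l ?B) - int (l ?C)) = M * j"
      using conjunct2[OF elim(3)] by (rule dvdE)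
    ultimately have i: "ang n x = int (l ?A) - int (l ?C) + M * i"
      and j: "ang n y = int (l ?B) - int (l ?C) + M * j" by linarith+
    have "M dvd (int (v ?B) - int (v ?C)) * (int (l ?A) - int (l ?C))
             - (int (v ?A) - int (v ?C)) * (int (l ?B) - int (l ?C))"
      using steinberg[of ?A ?B] elim unfolding v l by auto
    moreover have "tame n (x, y) = ((int (v ?B) - int (v ?C)) * (int (l ?A) - int (l ?C))
             - (int (v ?A) - int (v ?C)) * (int (l ?B) - int (l ?C)))
         + M * ((int (v ?B) - int (v ?C)) * i - (int (v ?A) - int (v ?C)) * j)"
      unfolding tame_def prod.case i j conjunct1[OF elim(2)] conjunct1[OF elim(3)] by (simp add: algebra_simps)
    ultimately show ?case by simp
  qed
qed

text \<open>
  As \<open>\<alpha>\<close> is a unit at the place and \<open>\<Phi>\<^sub>p(\<alpha>)\<close> has valuation \<open>e\<close>, the tame symbol of the square is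
  \<open>(-1/3)\<^sup>2\<^sup>e\<close>, which is not 1 even up to sign.
\<close>

lemma symbol_square_nontrivial:
  fixes u defines "u \<equiv> (\<Sum>i<p. \<alpha> ^ i)"
  assumes nz: "\<alpha> \<noteq> 0" "u \<noteq> 0" and u: "u \<in> carrier (rat_adjoin \<alpha>)"
  shows "K2_symbol (rat_adjoin \<alpha>) \<alpha> u [^]\<^bsub>milnor_K2 (rat_adjoin \<alpha>)\<^esub> (2 :: nat)
    \<noteq> \<one>\<^bsub>milnor_K2 (rat_adjoin \<alpha>)\<^esub>"
proof
  interpret F: field "rat_adjoin \<alpha>" by (rule field_rat_adjoin)
  let ?F = "rat_adjoin \<alpha>"
  assume "K2_symbol ?F \<alpha> u [^]\<^bsub>milnor_K2 ?F\<^esub> (2 :: nat) = \<one>\<^bsub>milnor_K2 ?F\<^esub>"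
  hence "\<forall>\<^sub>F n in sequentially. M dvd 2 * tame n (\<alpha>, u)"
  proof (rule F.K2_symbol_square_functional[rotated -1])
    show "\<forall>\<^sub>F n in sequentially. M dvd tame n (x, \<one>\<^bsub>?F\<^esub> \<ominus>\<^bsub>?F\<^esub> x)"
      if "x \<in> carrier ?F - {\<zero>\<^bsub>?F\<^esub>}" "\<one>\<^bsub>?F\<^esub> \<ominus>\<^bsub>?F\<^esub> x \<in> carrier ?F - {\<zero>\<^bsub>?F\<^esub>}" for x
    proof (rule tame_steinberg)
      show "x + (\<one>\<^bsub>?F\<^esub> \<ominus>\<^bsub>?F\<^esub> x) = 1"
        using that by (simp add: F.minus_eq rat_adjoin_ops rat_adjoin_uminus)
    qed (use that in \<open>auto simp: rat_adjoin_ops\<close>)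
  qed (use tame_left tame_right nz u rat_adjoin_generator in \<open>auto simp: rat_adjoin_ops\<close>)
  moreover have "\<forall>\<^sub>F n in sequentially.
    val n \<alpha> = int (v (at_approx [:0, 1:] n)) - int (v (at_approx 1 n)) \<and>
    M dvd ang n \<alpha> - (int (l (at_approx [:0, 1:] n)) - int (l (at_approx 1 n)))"
    by (rule val_ang_eq[OF rat_adjoin_generator nz(1)]) simp_all
  moreover have "\<forall>\<^sub>F n in sequentially.
    val n u = int (v (at_approx (\<Sum>i<p. Polynomial.monom 1 i) n)) - int (v (at_approx 1 n)) \<and>
    M dvd ang n u - (int (l (at_approx (\<Sum>i<p. Polynomial.monom 1 i) n)) - int (l (at_approx 1 n)))"
    by (rule val_ang_eq[OF u nz(2)]) (simp_all add: u_def)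
  moreover have "\<forall>\<^sub>F n in sequentially. e < n" by (rule eventually_gt_at_top)
  ultimately have "\<forall>\<^sub>F n in sequentially. False"
  proof eventually_elim
    case (elim n)
    have l1: "M dvd int (l 1)" using l_mult[of 1 1] by simp
    have "val n \<alpha> = 0" using elim(2) v_unit[OF residue_units(1)[OF approx_residue[of n]]] by simp
    moreover have "val n u = e"
      using elim(3) v_cyclotomic[OF approx_residue approx_root elim(4)] by (simp add: poly_sum poly_monom)
    ultimately have symbol: "M dvd 2 * (int e * ang n \<alpha>)" using elim(1) by (simp add: tame_def)
    have "M dvd ang n \<alpha> - (int (l (approx n)) - int (l 1))" using elim(2) by simp
    from dvd_diff[OF this l1]
    have "M dvd (2 * int e) * ((ang n \<alpha> - (int (l (approx n)) - int (l 1))) - int (l 1))" by (rule dvd_mult)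
    hence "M dvd 2 * (int e * ang n \<alpha>) - 2 * (int e * int (l (approx n)))" by (simp add: algebra_simps)
    from dvd_diff[OF symbol this] have "M dvd 2 * (int e * int (l (approx n)))" by simp
    thus ?case using log_root_not_dvd[OF approx_residue] by blast
  qed
  thus False by simp
qed

end

section \<open>The cyclotomic symbol of the root\<close>

theorem theorem9p10:
  fixes p :: nat and \<alpha> :: "'a::field_char_0"
  assumes "Factorial_Ring.prime p" and "p \<ge> 3"
    and "poly (Polynomial.monom 1 p + Polynomial.monom 1 (p - 1) + [:2:]) \<alpha> = 0"
  shows "\<alpha> \<noteq> 0 \<and>
         cyclotomic_eval (rat_adjoin \<alpha>) p \<alpha> \<noteq> 0 \<and>
         cyclotomic_eval (rat_adjoin \<alpha>) p (\<alpha>\<^sup>2) \<noteq> 0 \<and>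
         K2_cyclotomic (rat_adjoin \<alpha>) p \<alpha> [^]\<^bsub>milnor_K2 (rat_adjoin \<alpha>)\<^esub> (2::nat)
           \<noteq> \<one>\<^bsub>milnor_K2 (rat_adjoin \<alpha>)\<^esub> \<and>
         K2_cyclotomic (rat_adjoin \<alpha>) p \<alpha> [^]\<^bsub>milnor_K2 (rat_adjoin \<alpha>)\<^esub> (2::nat)
           = K2_cyclotomic (rat_adjoin \<alpha>) p (\<alpha>\<^sup>2) \<and>
         K2_cyclotomic (rat_adjoin \<alpha>) p (\<alpha>\<^sup>2) \<in> K2_cyclotomic_set (rat_adjoin \<alpha>) p"
proof -
  let ?F = "rat_adjoin \<alpha>"
  interpret F: field ?F by (rule field_rat_adjoin)
  define k where "k = p - 1"
  have k: "p = Suc k" and "even k" using assms(1,2) prime_odd_nat[of p] by (auto simp: k_def)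
  have root: "\<alpha> ^ p + \<alpha> ^ k + 2 = 0" using assms(3) by (simp add: poly_monom k_def)
  have root_int: "int_eval \<alpha> (trinomial p) = 0" using root by (simp add: trinomial_def k_def algebra_simps)
  have p0: "p > 0" using assms(2) by simp
  note id = trinomial_times_self[OF p0, of \<alpha>, unfolded root_int]
  define u where "u = (\<Sum>i<p. \<alpha> ^ i)"
  define w where "w = (\<Sum>i<p. (\<alpha>\<^sup>2) ^ i)"
  have nz: "\<alpha> \<noteq> 0" using root \<open>p \<ge> 3\<close> by (auto simp: k power_0_left)
  have nz1: "1 + \<alpha> \<noteq> 0"
  proof
    assume "1 + \<alpha> = 0"
    hence "\<alpha> = - 1" by (simp add: eq_neg_iff_add_eq_0 add.commute)
    thus False using root \<open>even k\<close> by (simp add: k)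
  qed
  have one: "\<alpha> \<noteq> 1" using root by auto
  have nzp: "1 + \<alpha> ^ p \<noteq> 0"
  proof
    assume h: "1 + \<alpha> ^ p = 0"
    have "1 + \<alpha> ^ k = (\<alpha> ^ p + \<alpha> ^ k + 2) - (1 + \<alpha> ^ p)" by simp
    hence "\<alpha> ^ k = - 1" unfolding root h by (simp add: eq_neg_iff_add_eq_0 add.commute)
    hence "\<alpha> = 1" using h by (simp add: k)
    thus False using one by simp
  qed
  have u_eq: "\<alpha> ^ p - 1 = (\<alpha> - 1) * u" unfolding u_def by (rule power_diff_1_eq)
  have w_eq: "(\<alpha>\<^sup>2) ^ p - 1 = (\<alpha>\<^sup>2 - 1) * w" unfolding w_def by (rule power_diff_1_eq)
  have unz: "u \<noteq> 0"
  proof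
    assume "u = 0"
    hence 1: "\<alpha> ^ p = 1" using u_eq by simp
    hence "3 * \<alpha> = - 1" using id by (simp add: eq_neg_iff_add_eq_0)
    hence "(3 * \<alpha>) ^ p = (- 1) ^ p" by simp
    hence "3 ^ p = (- 1 :: 'a)" unfolding power_mult_distrib 1 using \<open>even k\<close> by (simp add: k)
    hence "of_nat (3 ^ p + 1) = (0 :: 'a)" by simp
    thus False by (simp only: of_nat_eq_0_iff)
  qed
  \<comment> \<open>\<open>\<Phi>\<^sub>p(\<alpha>\<^sup>2) (\<alpha> + 1) = \<Phi>\<^sub>p(\<alpha>) (\<alpha>\<^sup>p + 1)\<close>, as both become \<open>\<alpha>\<^sup>2\<^sup>p - 1\<close> when multiplied by \<open>\<alpha> - 1\<close>.\<close>
  have "(\<alpha> - 1) * (w * (1 + \<alpha>)) = (\<alpha> - 1) * (u * (1 + \<alpha> ^ p))"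
  proof -
    have "(\<alpha> - 1) * (w * (1 + \<alpha>)) = (\<alpha>\<^sup>2) ^ p - 1"
      unfolding w_eq by (simp add: power2_eq_square algebra_simps)
    also have "\<dots> = (\<alpha> ^ p - 1) * (1 + \<alpha> ^ p)"
      by (simp add: power2_eq_square power_mult_distrib algebra_simps)
    finally show ?thesis unfolding u_eq by (simp add: mult_ac)
  qed
  hence uw: "w * (1 + \<alpha>) = u * (1 + \<alpha> ^ p)" using one by simp
  hence wnz: "w \<noteq> 0" using unz nzp by auto
  have \<alpha>: "\<alpha> \<in> carrier ?F" by (rule rat_adjoin_generator)
  have \<alpha>2: "\<alpha>\<^sup>2 \<in> carrier ?F" using F.nat_pow_closed[OF \<alpha>, of 2] by (simp add: rat_adjoin_ops)
  have cyc: "cyclotomic_eval ?F p x = (\<Sum>i<p. x ^ i)" "(\<Sum>i<p. x ^ i) \<in> carrier ?F" if "x \<in> carrier ?F" for x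
  proof -
    have fin: "(\<Oplus>\<^bsub>?F\<^esub>i\<in>I. x [^]\<^bsub>?F\<^esub> i) = (\<Sum>i\<in>I. x ^ i)" if "finite I" for I :: "nat set"
      using that
    proof (induction I)
      case (insert i I)
      have "(\<Oplus>\<^bsub>?F\<^esub>i\<in>insert i I. x [^]\<^bsub>?F\<^esub> i) = x [^]\<^bsub>?F\<^esub> i \<oplus>\<^bsub>?F\<^esub> (\<Oplus>\<^bsub>?F\<^esub>i\<in>I. x [^]\<^bsub>?F\<^esub> i)"
        using insert \<open>x \<in> carrier ?F\<close> by (intro F.finsum_insert) auto
      thus ?case using insert by (simp add: rat_adjoin_ops)
    qed (simp add: rat_adjoin_ops)
    show "cyclotomic_eval ?F p x = (\<Sum>i<p. x ^ i)"
      using F.cyclotomic_eval_prime[OF assms(1) that] fin by simp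
    have "(\<Oplus>\<^bsub>?F\<^esub>i\<in>{..<p}. x [^]\<^bsub>?F\<^esub> i) \<in> carrier ?F"
      using that by (intro F.finsum_closed) auto
    thus "(\<Sum>i<p. x ^ i) \<in> carrier ?F" using fin by simp
  qed
  have cu: "cyclotomic_eval ?F p \<alpha> = u" and u: "u \<in> carrier ?F"
    using cyc[OF \<alpha>] by (simp_all add: u_def)
  have cw: "cyclotomic_eval ?F p (\<alpha>\<^sup>2) = w" and w: "w \<in> carrier ?F"
    using cyc[OF \<alpha>2] by (simp_all add: w_def)
  have powc: "1 + \<alpha> ^ j \<in> carrier ?F" for j
    using F.a_closed[OF F.one_closed F.nat_pow_closed[OF \<alpha>], of j] by (simp add: rat_adjoin_ops)
  have eq: "K2_symbol ?F (\<alpha> [^]\<^bsub>?F\<^esub> (2 :: nat)) w = K2_symbol ?F \<alpha> u [^]\<^bsub>milnor_K2 ?F\<^esub> (2 :: nat)"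
  proof (rule F.K2_symbol_square_eq[where k = k])
    have "\<ominus>\<^bsub>?F\<^esub> (1 + \<alpha> ^ k) = - (1 + \<alpha> ^ k)" by (rule rat_adjoin_uminus[OF powc])
    also have "\<dots> = 1 + \<alpha> ^ Suc k" using root by (simp add: k eq_neg_iff_add_eq_0 algebra_simps)
    finally show "\<one>\<^bsub>?F\<^esub> \<oplus>\<^bsub>?F\<^esub> \<alpha> [^]\<^bsub>?F\<^esub> Suc k = \<ominus>\<^bsub>?F\<^esub> (\<one>\<^bsub>?F\<^esub> \<oplus>\<^bsub>?F\<^esub> \<alpha> [^]\<^bsub>?F\<^esub> k)"
      unfolding rat_adjoin_ops by simp
  qed (use \<alpha> nz u unz w wnz uw nz1 nzp powc[of 1] powc[of p] in
      \<open>simp_all only: rat_adjoin_ops k Diff_iff singleton_iff power_one_right not_False_eq_True simp_thms\<close>)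
  obtain q where q: "Factorial_Ring.prime q" "odd q" "q dvd 3 ^ p + 1" "\<not> q ^ p dvd 3 ^ p + 1" "2 * p < q"
    using prime_divisor_three_power_plus_one[OF assms(1,2)] .
  have q1: "int q dvd int (3 ^ p + 1)" "\<not> int (q ^ p) dvd int (3 ^ p + 1)"
    using q(3,4) by (simp_all only: of_nat_dvd_iff not_False_eq_True)
  obtain g where g: "residue_primroot q g" using prime_primitive_root_exists[of q] q(1) prime_gt_1_nat[OF q(1)] by auto
  interpret P: trinomial_place q g p
    by unfold_locales (use q q1 g assms in \<open>simp_all add: add.commute\<close>)
  obtain approx where "\<And>n. int q dvd 3 * approx n + 1 \<and> int q ^ n dvd poly (trinomial p) (approx n)"
    using P.approximate_root by metis
  then interpret C: trinomial_completion q g p \<alpha> approx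
    by unfold_locales (use root_int in auto)
  have "K2_symbol ?F \<alpha> u [^]\<^bsub>milnor_K2 ?F\<^esub> (2 :: nat) \<noteq> \<one>\<^bsub>milnor_K2 ?F\<^esub>"
    using C.symbol_square_nontrivial nz unz u unfolding u_def by blast
  moreover have "K2_cyclotomic ?F p (\<alpha>\<^sup>2) \<in> K2_cyclotomic_set ?F p"
    unfolding K2_cyclotomic_set_def carrier_mult_of
    using \<alpha>2 w nz wnz cw by (auto simp: rat_adjoin_ops)
  ultimately show ?thesis
    using nz unz wnz eq unfolding K2_cyclotomic_def cu cw by (simp add: rat_adjoin_ops)
qed

end
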